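(* Let $k\geq 3$, let $(w_n)_{n\in\mathbb{N}}$ be independent random variables each uniformly distributed on $[k]$, and let $W_n=w_1\cdots w_n$. Write $\mathcal{S}_k(n)=\mathcal{S}_k(W_n)$ and $\mathcal{J}_k(n)=\mathcal{J}_k(W_n)$. Then: (i) with probability one, $\lim_{n\to\infty}\frac{\mathcal{S}_k(n)}{n}=\psi_k:=\frac{(k-2)(k-1)}{k^2}$; (ii) there is a constant $\sigma_k\in(0,\infty)$ such that $\frac{\mathcal{S}_k(n)-\psi_k n}{\sigma_k\sqrt{n}}$ converges in distribution to a standard normal random variable as $n\to\infty$; (iii) with probability one, $\lim_{n\to\infty}\frac{\mathcal{J}_k(n)}{n}=\varphi_k:=\frac{3k-2}{k^2}$; (iv) there is a constant $\nu_k\in(0,\infty)$ such that $\frac{\mathcal{J}_k(n)-\varphi_k n}{\nu_k\sqrt{n}}$ converges in distribution to a standard normal random variable as $n\to\infty$.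
   Context: $[k]=\{1,\dots,k\}$ with its usual linear order. A word $\pi_1\cdots\pi_n$ is a staircase if $|\pi_{i+1}-\pi_i|\leq 1$ for all $i$. The staircase separation number $\mathcal{S}_k(\pi)$ of $\pi\in[k]^n$ is the number $d$ such that $\pi$ is a concatenation $\pi^{(1)}\cdots\pi^{(d+1)}$ of maximal staircase subwords (each $\pi^{(i)}$ is a staircase but $\pi^{(i)}$ followed by the first letter of $\pi^{(i+1)}$ is not); equivalently the number of indices $i$ with $|\pi_{i+1}-\pi_i|>1$. $\mathcal{J}_k(\pi)$ is defined by $i_1=1$, recursively $i_j=\inf\{m>i_{j-1}:|\pi_m-\pi_{i_{j-1}}|\leq 1\}$ (with $\inf\emptyset=+\infty$), and $\mathcal{J}_k(\pi)=\max\{r:i_r<\infty\}$ (the length of the longest left-most staircase subsequence). *)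

theory Defs
  imports "HOL-Probability.Probability"
begin

text \<open>Words over $[k]$ are lists of naturals with letters in \<open>{1..k}\<close>. The notions below do not
  depend on \<open>k\<close> once the word is given.\<close>

definition close_letters :: "nat \<Rightarrow> nat \<Rightarrow> bool" where
  "close_letters a b \<longleftrightarrow> \<bar>int b - int a\<bar> \<le> 1"

definition staircase :: "nat list \<Rightarrow> bool" where
  "staircase p \<longleftrightarrow> (\<forall>i. Suc i < length p \<longrightarrow> close_letters (p ! i) (p ! Suc i))"

definition staircase_decomposition :: "nat list \<Rightarrow> nat list list \<Rightarrow> bool" where
  "staircase_decomposition p ps \<longleftrightarrow>
     concat ps = p \<and>
     (\<forall>q \<in> set ps. q \<noteq> [] \<and> staircase q) \<and>
     (\<forall>i. Suc i < length ps \<longrightarrow> \<not> staircase (ps ! i @ [hd (ps ! Suc i)]))"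

text \<open>A nonempty word splits into \<open>d + 1\<close> maximal staircases; with truncated subtraction the
  empty word gets the value \<open>0\<close>. The description by the number of indices is proved in
  \<open>separation_number_eq_card\<close>.\<close>

definition separation_number :: "nat list \<Rightarrow> nat" where
  "separation_number p = (THE d. \<exists>ps. staircase_decomposition p ps \<and> d = length ps - 1)"

text \<open>\<open>leftmost_index p r\<close> is $i_r$: both \<open>r\<close> and the positions in \<open>p\<close> are counted from 1, so
  the letter at position \<open>m\<close> is \<open>p ! (m - 1)\<close>. The value at \<open>r = 0\<close> is a dummy. The infimum is
  taken in \<^typ>\<open>enat\<close>, where the infimum of the empty set is \<open>\<infinity>\<close>; if the previous index is \<open>\<infinity>\<close>
  then the set is empty.\<close>

fun leftmost_index :: "nat list \<Rightarrow> nat \<Rightarrow> enat" where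
  "leftmost_index p 0 = 0"
| "leftmost_index p (Suc 0) = 1"
| "leftmost_index p (Suc (Suc r)) =
     Inf {enat m | m. leftmost_index p (Suc r) < enat m \<and> m \<le> length p \<and>
            close_letters (p ! (the_enat (leftmost_index p (Suc r)) - 1)) (p ! (m - 1))}"

definition leftmost_length :: "nat list \<Rightarrow> nat" where
  "leftmost_length p = Max {r. 1 \<le> r \<and> leftmost_index p r < \<infinity>}"

definition random_word :: "(nat \<Rightarrow> 'a \<Rightarrow> nat) \<Rightarrow> nat \<Rightarrow> 'a \<Rightarrow> nat list" where
  "random_word w n \<omega> = map (\<lambda>i. w i \<omega>) [1..<Suc n]"

definition psi :: "nat \<Rightarrow> real" where
  "psi k = (real k - 2) * (real k - 1) / (real k)\<^sup>2"

definition phi :: "nat \<Rightarrow> real" where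
  "phi k = (3 * real k - 2) / (real k)\<^sup>2"


subsection \<open>Well-definedness\<close>

fun far_steps :: "nat list \<Rightarrow> nat" where
  "far_steps (a # b # p) = (if close_letters a b then 0 else 1) + far_steps (b # p)"
| "far_steps _ = 0"

lemma staircase_simps:
  "staircase []" "staircase [a]"
  "staircase (a # b # p) \<longleftrightarrow> close_letters a b \<and> staircase (b # p)"
proof -
  have all_nat: "(\<forall>i. P i) \<longleftrightarrow> P 0 \<and> (\<forall>i. P (Suc i))" for P :: "nat \<Rightarrow> bool"
    by (metis not0_implies_Suc)
  show "staircase (a # b # p) \<longleftrightarrow> close_letters a b \<and> staircase (b # p)"
    unfolding staircase_def by (subst all_nat) auto
qed (auto simp: staircase_def)

lemma far_steps_eq_card:
  "far_steps p = card {i. Suc i < length p \<and> \<not> close_letters (p ! i) (p ! Suc i)}"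
proof (induction p rule: far_steps.induct)
  case (1 a b p)
  let ?A = "{i. Suc i < length (b # p) \<and> \<not> close_letters ((b # p) ! i) ((b # p) ! Suc i)}"
  let ?B = "{i. Suc i < length (a # b # p) \<and> \<not> close_letters ((a # b # p) ! i) ((a # b # p) ! Suc i)}"
  have mem: "i \<in> ?B \<longleftrightarrow> i \<in> (if close_letters a b then {} else {0}) \<union> Suc ` ?A" for i
    by (cases i) auto
  have "?B = (if close_letters a b then {} else {0}) \<union> Suc ` ?A"
    using mem by blast
  moreover have "finite ?A"
    by (rule finite_subset[of _ "{..<length (b # p)}"]) auto
  ultimately have "card ?B = (if close_letters a b then 0 else 1) + card ?A"
    by (auto simp: card_image)
  then show ?case using 1 by simp
qed auto

lemma staircase_append_single:
  "q \<noteq> [] \<Longrightarrow> staircase (q @ [c]) \<longleftrightarrow> staircase q \<and> close_letters (last q) c"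
  by (induction q rule: induct_list012) (auto simp: staircase_simps)

lemma far_steps_append:
  assumes "staircase q" "q \<noteq> []"
  shows "far_steps (q @ r) =
    (if r = [] \<or> close_letters (last q) (hd r) then 0 else 1) + far_steps r"
  using assms
proof (induction q rule: induct_list012)
  case (2 a)
  then show ?case by (cases r) auto
qed (auto simp: staircase_simps)

lemma staircase_decomposition_Cons:
  "staircase_decomposition p (q # qs) \<longleftrightarrow>
     (\<exists>r. p = q @ r \<and> q \<noteq> [] \<and> staircase q \<and> staircase_decomposition r qs \<and>
        (qs \<noteq> [] \<longrightarrow> \<not> close_letters (last q) (hd (hd qs))))"
proof -
  have all_nat: "(\<forall>i. P i) \<longleftrightarrow> P 0 \<and> (\<forall>i. P (Suc i))" for P :: "nat \<Rightarrow> bool"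
    by (metis not0_implies_Suc)
  show ?thesis
    unfolding staircase_decomposition_def
    by (subst all_nat) (auto simp: staircase_append_single hd_conv_nth)
qed

lemma staircase_decomposition_length:
  "staircase_decomposition p ps \<Longrightarrow> length ps - 1 = far_steps p"
proof (induction ps arbitrary: p)
  case Nil
  then show ?case by (auto simp: staircase_decomposition_def)
next
  case (Cons q qs)
  then obtain r where r: "p = q @ r" "q \<noteq> []" "staircase q" "staircase_decomposition r qs"
    "qs \<noteq> [] \<longrightarrow> \<not> close_letters (last q) (hd (hd qs))"
    by (auto simp: staircase_decomposition_Cons)
  show ?case
  proof (cases qs)
    case Nil
    then show ?thesis
      using r far_steps_append[of q r] by (auto simp: staircase_decomposition_def)
  next
    case (Cons q' qs')
    then have "r \<noteq> []" "hd r = hd (hd qs)"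
      using r(4) by (auto simp: staircase_decomposition_Cons)
    then show ?thesis
      using r far_steps_append[of q r] Cons.IH[OF r(4)] Cons by auto
  qed
qed

lemma staircase_decomposition_exists: "\<exists>ps. staircase_decomposition p ps"
proof (induction p rule: induct_list012)
  case 1
  then show ?case by (intro exI[of _ "[]"]) (auto simp: staircase_decomposition_def)
next
  case (2 a)
  then show ?case
    by (intro exI[of _ "[[a]]"]) (auto simp: staircase_decomposition_def staircase_simps)
next
  case (3 a b p)
  then obtain ps where ps: "staircase_decomposition (b # p) ps" by blast
  then obtain q qs where [simp]: "ps = q # qs"
    by (cases ps) (auto simp: staircase_decomposition_def)
  obtain r where r: "b # p = q @ r" "q \<noteq> []" "staircase q" "staircase_decomposition r qs"
    "qs \<noteq> [] \<longrightarrow> \<not> close_letters (last q) (hd (hd qs))"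
    using ps by (auto simp: staircase_decomposition_Cons)
  then obtain q' where q': "q = b # q'" by (cases q) auto
  show ?case
  proof (cases "close_letters a b")
    case True
    then have "staircase_decomposition (a # b # p) ((a # q) # qs)"
      using r q' by (auto simp: staircase_decomposition_Cons staircase_simps)
    then show ?thesis by blast
  next
    case False
    have "staircase_decomposition (a # b # p) ([a] # ps)"
      using ps False q'
      by (subst staircase_decomposition_Cons) (auto simp: staircase_simps)
    then show ?thesis by blast
  qed
qed

lemma separation_number_eq_card:
  "separation_number p = card {i. Suc i < length p \<and> \<not> close_letters (p ! i) (p ! Suc i)}"
proof -
  obtain ps where ps: "staircase_decomposition p ps"
    using staircase_decomposition_exists by blast
  have "separation_number p = far_steps p"
    unfolding separation_number_def
  proof (rule the_equality)
    show "\<exists>ps. staircase_decomposition p ps \<and> far_steps p = length ps - 1"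
      using ps staircase_decomposition_length[OF ps] by (intro exI[of _ ps]) simp
  next
    fix d assume "\<exists>ps. staircase_decomposition p ps \<and> d = length ps - 1"
    then show "d = far_steps p" using staircase_decomposition_length by auto
  qed
  then show ?thesis by (simp add: far_steps_eq_card)
qed

lemma enat_Inf_mem:
  fixes X :: "enat set"
  assumes "Inf X < \<infinity>"
  shows "Inf X \<in> X"
proof -
  have "X \<noteq> {}" using assms by (auto simp: Inf_enat_def)
  then show ?thesis unfolding Inf_enat_def by (metis LeastI_ex equals0I)
qed

lemma leftmost_index_bounds:
  assumes "1 \<le> r" "leftmost_index p r < \<infinity>"
  shows "enat r \<le> leftmost_index p r \<and> leftmost_index p r \<le> enat (max 1 (length p))"
  using assms
proof (induction p r rule: leftmost_index.induct)
  case (2 p)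
  then show ?case by (simp add: one_enat_def)
next
  case (3 p r)
  let ?X = "{enat m | m. leftmost_index p (Suc r) < enat m \<and> m \<le> length p \<and>
            close_letters (p ! (the_enat (leftmost_index p (Suc r)) - 1)) (p ! (m - 1))}"
  have fin: "Inf ?X < \<infinity>" using "3.prems"(2) by (simp only: leftmost_index.simps)
  have "Inf ?X \<in> ?X"
    using fin by (rule enat_Inf_mem)
  then obtain m where m: "Inf ?X = enat m" "leftmost_index p (Suc r) < enat m" "m \<le> length p"
    by blast
  have "enat (Suc r) \<le> leftmost_index p (Suc r)"
    using 3(1) m(2) by (cases "leftmost_index p (Suc r)") auto
  then have "enat (Suc r) < enat m" using m(2) by (rule le_less_trans)
  then have "enat (Suc (Suc r)) \<le> enat m" "enat m \<le> enat (max 1 (length p))"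
    using m(3) by auto
  then show ?case by (simp only: leftmost_index.simps m(1))
qed simp

lemma leftmost_length_set:
  "finite {r. 1 \<le> r \<and> leftmost_index p r < \<infinity>}"
  "1 \<in> {r. 1 \<le> r \<and> leftmost_index p r < \<infinity>}"
proof -
  have "r \<le> max 1 (length p)" if "1 \<le> r" "leftmost_index p r < \<infinity>" for r
    using order_trans[OF conjunct1 conjunct2, OF leftmost_index_bounds[OF that]
        leftmost_index_bounds[OF that]] by (simp only: enat_ord_simps)
  then have "{r. 1 \<le> r \<and> leftmost_index p r < \<infinity>} \<subseteq> {..max 1 (length p)}"
    by blast
  then show "finite {r. 1 \<le> r \<and> leftmost_index p r < \<infinity>}"
    by (rule finite_subset) simp
qed (simp add: one_enat_def)

end

theory Submission
  imports Defs "HOL-Real_Asymp.Real_Asymp"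
begin

text \<open>Both statistics are additive functionals $\sum_i h(X_i, w_{i+1})$ of a finite Markov chain
  $X_{i+1} = g(X_i, w_{i+1})$ driven by the letters. For the separation number $X_i$ is the last
  letter read, for the leftmost staircase subsequence it is the last letter selected.
  If $f$ solves the Poisson equation $f - Pf = \bar h - m$ with $\bar h(x) = E\, h(x, w)$, then
  $\sum_i h - mn$ differs by a bounded amount from a sum $S_n$ of bounded martingale differences
  $D(X_i, w_{i+1})$. The fourth moment of $S_n$ is $O(n^2)$, which gives the law of large numbers.
  For the central limit theorem let $U$ solve the Poisson equation for the conditional variance
  $V(x) = E\, D(x, w)^2$ with mean $\sigma^2$. Then
  $a_n = E\, e^{i \theta S_n} (1 - \theta^2 U(X_n)/2)$ satisfies
  $a_{n+1} = (1 - \theta^2 \sigma^2/2) a_n + O(\theta^3)$; put $\theta = t/(\sigma\sqrt n)$ and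
  apply Levy's continuity theorem. The variance is positive because the letter
  $1$ keeps the chain at $1$, where $D(1, 1) = h(1, 1) - m \neq 0$.\<close>

section \<open>Additive functionals of a recursion driven by letters, and the separation
  number\<close>

fun chain_sum :: "('s \<Rightarrow> 'b \<Rightarrow> 's) \<Rightarrow> ('s \<Rightarrow> 'b \<Rightarrow> real) \<Rightarrow> 's \<Rightarrow> 'b list \<Rightarrow> real" where
  "chain_sum g h x [] = 0"
| "chain_sum g h x (a # l) = h x a + chain_sum g h (g x a) l"

text \<open>The recursion consumes the word from the front, but a random word grows at its end; this
  form isolates the contribution of the newest letter given the current state.\<close>

lemma chain_sum_snoc:
  "chain_sum g h x (l @ [a]) = chain_sum g h x l + h (foldl g x l) a"
  by (induction l arbitrary: x) auto

text \<open>State \<open>0\<close> means that no letter has been read; the chain moves from it to the first letter.\<close>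

definition far_step :: "nat \<Rightarrow> nat \<Rightarrow> real" where
  "far_step x a = (if x = 0 \<or> close_letters x a then 0 else 1)"

definition stair_move :: "nat \<Rightarrow> nat \<Rightarrow> nat" where
  "stair_move x a = (if x = 0 \<or> close_letters x a then a else x)"

definition stair_step :: "nat \<Rightarrow> nat \<Rightarrow> real" where
  "stair_step x a = (if x = 0 \<or> close_letters x a then 1 else 0)"

text \<open>Letters are at least \<open>1\<close>, so the state never equals the dummy
  \<open>0\<close> and \<open>far_step\<close> tests closeness at every step.\<close>

lemma far_steps_Cons_eq_chain_sum:
  "b \<ge> 1 \<Longrightarrow> set p \<subseteq> {1..} \<Longrightarrow>
    real (far_steps (b # p)) = chain_sum (\<lambda>x a. a) far_step b p"
  by (induction p arbitrary: b) (auto simp: far_step_def)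

lemma separation_number_eq_chain_sum:
  assumes "set p \<subseteq> {1..}"
  shows "real (separation_number p) = chain_sum (\<lambda>x a. a) far_step 0 p"
proof -
  have "separation_number p = far_steps p"
    by (simp add: separation_number_eq_card far_steps_eq_card)
  then show ?thesis
    using assms by (cases p) (auto simp: far_steps_Cons_eq_chain_sum far_step_def)
qed

subsection \<open>The leftmost staircase subsequence as a chain\<close>

text \<open>The set whose infimum is the next index, named so that the candidates in
  \<open>p\<close> and in \<open>p @ [c]\<close> can be compared. It is empty for
  \<open>i = \<infinity>\<close>.\<close>

definition next_positions :: "nat list \<Rightarrow> enat \<Rightarrow> enat set" where
  "next_positions p i = {enat m | m. i < enat m \<and> m \<le> length p \<and>
     close_letters (p ! (the_enat i - 1)) (p ! (m - 1))}"

lemma leftmost_index_Suc: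
  "r \<ge> 1 \<Longrightarrow> leftmost_index p (Suc r) = Inf (next_positions p (leftmost_index p r))"
  by (cases r) (simp, simp only: next_positions_def leftmost_index.simps)

text \<open>Since position \<open>i\<close> lies inside \<open>p\<close>, its letter is the same in
  both words, and the only new candidate is the appended position.\<close>

lemma next_positions_snoc:
  assumes "1 \<le> i" "i \<le> length p"
  shows "next_positions (p @ [c]) (enat i) = next_positions p (enat i) \<union>
    (if close_letters (p ! (i - 1)) c then {enat (Suc (length p))} else {})"
proof (intro set_eqI)
  fix y
  show "y \<in> next_positions (p @ [c]) (enat i) \<longleftrightarrow> y \<in> next_positions p (enat i) \<union>
    (if close_letters (p ! (i - 1)) c then {enat (Suc (length p))} else {})"
  proof (cases y)
    case (enat m)
    consider "m = 0" | "1 \<le> m" "m \<le> length p" | "m = Suc (length p)" | "m > Suc (length p)"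
      by linarith
    then show ?thesis
      using assms by cases (auto simp: next_positions_def nth_append enat)
  qed (simp add: next_positions_def)
qed

text \<open>No position exceeds \<open>\<infinity>\<close>, so the candidate set stays empty; hence
  the ranks with finite index form an initial segment.\<close>

lemma leftmost_index_infinity_mono:
  assumes "1 \<le> r" "r \<le> s" "leftmost_index p r = \<infinity>"
  shows "leftmost_index p s = \<infinity>"
  using assms(2,1,3)
proof (induction s rule: dec_induct)
  case (step n)
  then show ?case by (simp add: leftmost_index_Suc next_positions_def Inf_enat_def)
qed

text \<open>The appended position lies beyond all positions of \<open>p\<close>, so it cannot lower
  an infimum that is already finite.\<close>

lemma leftmost_index_snoc:
  assumes "p \<noteq> []" "1 \<le> r" "leftmost_index p r < \<infinity>"
  shows "leftmost_index (p @ [c]) r = leftmost_index p r"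
  using assms(2,3)
proof (induction r rule: nat_induct_at_least)
  case base
  then show ?case by simp
next
  case (Suc r)
  have fin: "leftmost_index p r < \<infinity>"
  proof (rule ccontr)
    assume "\<not> leftmost_index p r < \<infinity>"
    then have "leftmost_index p (Suc r) = \<infinity>"
      using leftmost_index_infinity_mono[of r "Suc r" p] Suc.hyps by simp
    then show False using Suc.prems by simp
  qed
  then obtain i where i: "leftmost_index p r = enat i" by auto
  \<comment> \<open>As \<open>p\<close> is nonempty, the general bound
    \<open>max 1 (length p)\<close> is \<open>length p\<close>, so \<open>i\<close> is a genuine
    position of \<open>p\<close>.\<close>
  have bd: "1 \<le> i" "i \<le> length p"
    using leftmost_index_bounds[OF Suc.hyps fin] i Suc.hyps assms(1)
    by (auto simp: Suc_le_eq max_def split: if_splits)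
  have "Inf (next_positions p (enat i)) < \<infinity>"
    using Suc.prems Suc.hyps i by (simp add: leftmost_index_Suc)
  then have "Inf (next_positions p (enat i)) \<in> next_positions p (enat i)"
    by (rule enat_Inf_mem)
  then have "Inf (next_positions p (enat i)) \<le> enat (Suc (length p))"
    by (auto simp: next_positions_def)
  then have "Inf (next_positions (p @ [c]) (enat i)) = Inf (next_positions p (enat i))"
    unfolding next_positions_snoc[OF bd] by (auto simp: Inf_union_distrib inf_absorb1)
  then show ?case using Suc i fin by (simp add: leftmost_index_Suc)
qed

text \<open>The invariant that links the indices to the chain. The chain sum counts the finite
  indices and the state is the letter at the last of them. A new letter close to the state receives
  index number \<open>Suc J\<close>; any other letter leaves everything as it was.\<close>

lemma leftmost_index_last:
  assumes "p \<noteq> []" "set p \<subseteq> {1..}"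
  shows "\<exists>J i. J \<ge> 1 \<and> chain_sum stair_move stair_step 0 p = real J \<and>
    leftmost_index p J = enat i \<and> 1 \<le> i \<and> i \<le> length p \<and>
    p ! (i - 1) = foldl stair_move 0 p \<and> leftmost_index p (Suc J) = \<infinity>"
  using assms
proof (induction p rule: rev_nonempty_induct)
  case (single a)
  have "next_positions [a] 1 = {}" by (auto simp: next_positions_def one_enat_def)
  then show ?case
    by (intro exI[of _ "1::nat"])
      (auto simp: stair_move_def stair_step_def leftmost_index_Suc one_enat_def Inf_enat_def)
next
  case (snoc c p)
  then obtain J i where J: "J \<ge> 1" "chain_sum stair_move stair_step 0 p = real J"
    "leftmost_index p J = enat i" "1 \<le> i" "i \<le> length p"
    "p ! (i - 1) = foldl stair_move 0 p" "leftmost_index p (Suc J) = \<infinity>"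
    by auto
  \<comment> \<open>The state is a letter of \<open>p\<close>, hence nonzero, so the dummy branch of
    \<open>stair_move\<close> and \<open>stair_step\<close> does not fire.\<close>
  have pos: "foldl stair_move 0 p \<noteq> 0"
  proof -
    have "p ! (i - 1) \<in> set p" using J(4,5) by simp
    then show ?thesis using snoc.prems J(6) by auto
  qed
  have inf: "Inf (next_positions p (enat i)) = \<infinity>"
    using J(1,3,7) leftmost_index_Suc[of J p] by simp
  \<comment> \<open>All candidates are finite, so an infinite infimum means that there are none;
    after appending \<open>c\<close> only its own position can qualify.\<close>
  have empty: "next_positions p (enat i) = {}"
  proof (intro equals0I)
    fix y assume y: "y \<in> next_positions p (enat i)"
    then have "y \<ge> \<infinity>" using Inf_lower[OF y] inf by simp
    then show False using y by (auto simp: next_positions_def)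
  qed
  have J': "leftmost_index (p @ [c]) J = enat i"
    using leftmost_index_snoc[OF snoc.hyps(1) J(1), of c] J(3) by simp
  have SucJ: "leftmost_index (p @ [c]) (Suc J) =
    (if close_letters (foldl stair_move 0 p) c then enat (Suc (length p)) else \<infinity>)"
    using leftmost_index_Suc[OF J(1), of "p @ [c]"]
    unfolding J' next_positions_snoc[OF J(4,5)] J(6) empty
    by (simp add: top_enat_def inf_absorb1)
  show ?case
  proof (cases "close_letters (foldl stair_move 0 p) c")
    case True
    have "next_positions (p @ [c]) (enat (Suc (length p))) = {}"
      by (auto simp: next_positions_def)
    then have "leftmost_index (p @ [c]) (Suc (Suc J)) = \<infinity>"
      using SucJ True leftmost_index_Suc[of "Suc J" "p @ [c]"] by (simp add: Inf_enat_def)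
    moreover have "chain_sum stair_move stair_step 0 (p @ [c]) = real (Suc J)"
      using True J(2) by (simp add: chain_sum_snoc stair_step_def)
    moreover have "foldl stair_move 0 (p @ [c]) = (p @ [c]) ! (Suc (length p) - 1)"
      using True by (simp add: stair_move_def)
    moreover have "leftmost_index (p @ [c]) (Suc J) = enat (Suc (length p))"
      using SucJ True by (simp only: if_True)
    moreover have "1 \<le> Suc J" "1 \<le> Suc (length p)" "Suc (length p) \<le> length (p @ [c])"
      by simp_all
    ultimately show ?thesis by metis
  next
    case False
    then have "leftmost_index (p @ [c]) (Suc J) = \<infinity>"
      using SucJ by (simp only: if_False)
    moreover have "chain_sum stair_move stair_step 0 (p @ [c]) = real J"
      using False pos J(2) by (simp add: chain_sum_snoc stair_step_def)
    moreover have "foldl stair_move 0 (p @ [c]) = (p @ [c]) ! (i - 1)"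
    proof -
      have "i - 1 < length p" using J(4,5) by linarith
      then show ?thesis using False pos J(6) by (simp add: stair_move_def nth_append)
    qed
    moreover have "i \<le> length (p @ [c])"
      using J(5) by simp
    ultimately show ?thesis using J' J(1,4) by metis
  qed
qed

text \<open>All indices after the \<open>J\<close> of the invariant are infinite. The empty word is
  excluded because its first index is \<open>1\<close> by convention, which gives length 1 against
  an empty sum.\<close>

lemma leftmost_length_eq_chain_sum:
  assumes "p \<noteq> []" "set p \<subseteq> {1..}"
  shows "real (leftmost_length p) = chain_sum stair_move stair_step 0 p"
proof -
  obtain J i where J: "J \<ge> 1" "chain_sum stair_move stair_step 0 p = real J"
    "leftmost_index p J = enat i" "leftmost_index p (Suc J) = \<infinity>"
    using leftmost_index_last[OF assms] by blast
  have "leftmost_length p = J"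
    unfolding leftmost_length_def
  proof (rule Max_eqI)
    show "finite {r. 1 \<le> r \<and> leftmost_index p r < \<infinity>}" by (rule leftmost_length_set)
    fix r assume "r \<in> {r. 1 \<le> r \<and> leftmost_index p r < \<infinity>}"
    then show "r \<le> J"
      using leftmost_index_infinity_mono[of "Suc J" r p] J(4) by (cases "r \<le> J") auto
  qed (use J in auto)
  then show ?thesis using J by simp
qed

subsection \<open>Uniformly distributed letters\<close>

text \<open>Expectation over one uniform letter. Values in a real vector space cover both real
  moments and complex characteristic functions.\<close>

definition avg :: "nat \<Rightarrow> (nat \<Rightarrow> 'b) \<Rightarrow> 'b::real_vector" where
  "avg k v = (1 / real k) *\<^sub>R (\<Sum>a=1..k. v a)"

lemma avg_add: "avg k (\<lambda>a. u a + v a) = avg k u + avg k v"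
  by (simp add: avg_def sum.distrib scaleR_right_distrib)

lemma avg_diff: "avg k (\<lambda>a. u a - v a) = avg k u - avg k v"
  by (simp add: avg_def sum_subtractf scaleR_right_diff_distrib)

lemma avg_const: "k \<ge> 1 \<Longrightarrow> avg k (\<lambda>a. c) = c"
  by (simp add: avg_def sum_constant_scaleR)

lemma avg_mult_left:
  fixes c :: "'b::real_algebra"
  shows "avg k (\<lambda>a. c * v a) = c * avg k v"
  by (simp add: avg_def sum_distrib_left)

lemma avg_cong: "(\<And>a. a \<in> {1..k} \<Longrightarrow> u a = v a) \<Longrightarrow> avg k u = avg k v"
  unfolding avg_def by (intro arg_cong[where f = "scaleR _"] sum.cong) auto

lemma avg_mono:
  fixes u v :: "nat \<Rightarrow> real"
  shows "(\<And>a. a \<in> {1..k} \<Longrightarrow> u a \<le> v a) \<Longrightarrow> avg k u \<le> avg k v"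
  unfolding avg_def by (auto intro!: divide_right_mono sum_mono)

lemma norm_avg_le:
  fixes v :: "nat \<Rightarrow> 'b::real_normed_vector"
  assumes "k \<ge> 1" "\<And>a. a \<in> {1..k} \<Longrightarrow> norm (v a) \<le> B"
  shows "norm (avg k v) \<le> B"
proof -
  have "norm (\<Sum>a=1..k. v a) \<le> (\<Sum>a=1..k. B)"
    using assms(2) by (rule sum_norm_le)
  then show ?thesis using assms(1) by (simp add: avg_def field_simps)
qed

lemma of_real_avg: "of_real (avg k v) = (avg k (\<lambda>a. of_real (v a)) :: complex)"
  by (simp add: avg_def scaleR_conv_of_real)

section \<open>Expectations of functions of a random word as finite sums\<close>

definition words :: "nat \<Rightarrow> nat \<Rightarrow> nat list set" where
  "words k n = {l. set l \<subseteq> {1..k} \<and> length l = n}"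

lemma finite_words: "finite (words k n)"
  unfolding words_def by (rule finite_lists_length_eq) simp

lemma sum_words_Suc: "(\<Sum>l\<in>words k (Suc n). F l) = (\<Sum>l\<in>words k n. \<Sum>a=1..k. F (l @ [a]))"
proof -
  have "bij_betw (\<lambda>(l, a). l @ [a]) (words k n \<times> {1..k}) (words k (Suc n))"
  proof (rule bij_betw_byWitness[where f' = "\<lambda>l. (butlast l, last l)"])
    show "(\<lambda>l. (butlast l, last l)) ` words k (Suc n) \<subseteq> words k n \<times> {1..k}"
      by (auto simp: words_def dest: in_set_butlastD)
        (metis One_nat_def atLeastAtMost_iff last_in_set length_0_conv nat.distinct(1) subsetD)+
  qed (auto simp: words_def intro!: append_butlast_last_id)
  from sum.reindex_bij_betw[OF this, of F] show ?thesis
    by (simp add: sum.cartesian_product case_prod_unfold)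
qed

locale uniform_letters = prob_space M for M :: "'a measure" +
  fixes k :: nat and w :: "nat \<Rightarrow> 'a \<Rightarrow> nat"
  assumes k_pos: "k \<ge> 1"
    and indep: "indep_vars (\<lambda>_. count_space {1..k}) w {1..}"
    and unif: "\<And>n. n \<ge> 1 \<Longrightarrow> distr M (count_space {1..k}) (w n) = uniform_count_measure {1..k}"
begin

abbreviation "W \<equiv> random_word w"

lemma letter_measurable: "n \<ge> 1 \<Longrightarrow> w n \<in> measurable M (count_space {1..k})"
  using indep by (auto simp: indep_vars_def)

lemma letter_bounds: "n \<ge> 1 \<Longrightarrow> \<omega> \<in> space M \<Longrightarrow> w n \<omega> \<in> {1..k}"
  using measurable_space[OF letter_measurable] by auto

lemma prob_letter:
  assumes "n \<ge> 1" "a \<in> {1..k}"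
  shows "prob (w n -` {a} \<inter> space M) = 1 / real k"
proof -
  have "prob (w n -` {a} \<inter> space M) = measure (uniform_count_measure {1..k}) {a}"
    unfolding unif[OF assms(1), symmetric]
    using assms by (subst measure_distr) (auto simp: letter_measurable[unfolded One_nat_def])
  then show ?thesis using assms by (simp add: measure_uniform_count_measure)
qed

lemma random_word_in_words: "\<omega> \<in> space M \<Longrightarrow> W n \<omega> \<in> words k n"
  using letter_bounds by (fastforce simp: random_word_def words_def)

lemma random_word_Suc: "W (Suc n) \<omega> = W n \<omega> @ [w (Suc n) \<omega>]"
  by (simp add: random_word_def)

text \<open>Writes the event as a cylinder, ready for independence. The case \<open>n = 0\<close> is
  different: an empty intersection is \<open>UNIV\<close>, not \<open>space M\<close>.\<close>

lemma random_word_event: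
  assumes "length l = n" "n \<ge> 1"
  shows "{\<omega> \<in> space M. W n \<omega> = l} = (\<Inter>i\<in>{1..n}. w i -` {l ! (i - 1)} \<inter> space M)"
proof -
  have "W n \<omega> = l \<longleftrightarrow> (\<forall>i\<in>{1..n}. w i \<omega> = l ! (i - 1))" for \<omega>
  proof
    assume "W n \<omega> = l"
    then show "\<forall>i\<in>{1..n}. w i \<omega> = l ! (i - 1)"
      by (auto simp: random_word_def simp del: upt_Suc)
  next
    assume "\<forall>i\<in>{1..n}. w i \<omega> = l ! (i - 1)"
    then show "W n \<omega> = l"
      using assms by (auto intro!: nth_equalityI simp: random_word_def simp del: upt_Suc)
  qed
  then show ?thesis using assms by auto
qed

lemma random_word_event_sets: "{\<omega> \<in> space M. W n \<omega> = l} \<in> events"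
proof (induction n arbitrary: l)
  case 0
  then show ?case by (cases l) (auto simp: random_word_def)
next
  case (Suc n)
  show ?case
  proof (cases l rule: rev_cases)
    case Nil
    then show ?thesis by (simp add: random_word_Suc)
  next
    case (snoc l' a)
    \<comment> \<open>The letter \<open>a\<close> is arbitrary and may lie outside
      \<open>{1..k}\<close>; intersecting with \<open>{1..k}\<close> gives a measurable set and, on
      \<open>space M\<close>, the same event.\<close>
    have "w (Suc n) -` ({a} \<inter> {1..k}) \<inter> space M \<in> events"
      by (rule measurable_sets[OF letter_measurable]) auto
    then have "{\<omega> \<in> space M. W n \<omega> = l'} \<inter> (w (Suc n) -` ({a} \<inter> {1..k}) \<inter> space M) \<in> events"
      using Suc by blast
    also have "{\<omega> \<in> space M. W n \<omega> = l'} \<inter> (w (Suc n) -` ({a} \<inter> {1..k}) \<inter> space M) =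
        {\<omega> \<in> space M. W (Suc n) \<omega> = l}"
      using letter_bounds[of "Suc n"] by (auto simp: random_word_Suc snoc)
    finally show ?thesis .
  qed
qed

lemma prob_random_word:
  assumes "l \<in> words k n"
  shows "prob {\<omega> \<in> space M. W n \<omega> = l} = (1 / real k) ^ n"
proof (cases "n = 0")
  case True
  then show ?thesis using assms by (simp add: random_word_def words_def prob_space)
next
  case False
  have l: "length l = n" "set l \<subseteq> {1..k}" using assms by (auto simp: words_def)
  have mem: "l ! (i - 1) \<in> {1..k}" if "i \<in> {1..n}" for i
    using that l nth_mem[of "i - 1" l] by force
  have "prob {\<omega> \<in> space M. W n \<omega> = l} = (\<Prod>i\<in>{1..n}. prob (w i -` {l ! (i - 1)} \<inter> space M))"
    using False l mem by (subst random_word_event, simp, simp)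
      (rule indep_varsD[OF indep], auto)
  also have "\<dots> = (\<Prod>i\<in>{1..n}. 1 / real k)"
    using mem by (intro prod.cong) (auto intro!: prob_letter)
  finally show ?thesis by simp
qed

text \<open>The random word takes finitely many values, so every function of it is simple;
  integrability and measurability then hold for arbitrary \<open>F\<close>.\<close>

lemma random_word_function_expand:
  fixes F :: "nat list \<Rightarrow> 'b::real_vector"
  assumes "\<omega> \<in> space M"
  shows "F (W n \<omega>) = (\<Sum>l\<in>words k n. indicator {\<omega> \<in> space M. W n \<omega> = l} \<omega> *\<^sub>R F l)"
proof -
  have "(\<Sum>l\<in>words k n. indicator {\<omega> \<in> space M. W n \<omega> = l} \<omega> *\<^sub>R F l) =
      (\<Sum>l\<in>words k n. if W n \<omega> = l then F l else 0)"
    using assms by (intro sum.cong) auto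
  then show ?thesis
    using random_word_in_words[OF assms, of n] by (simp add: finite_words)
qed

lemma integrable_random_word:
  fixes F :: "nat list \<Rightarrow> 'b::{banach, second_countable_topology}"
  shows "integrable M (\<lambda>\<omega>. F (W n \<omega>))"
proof -
  have "integrable M (\<lambda>\<omega>. \<Sum>l\<in>words k n. indicator {\<omega> \<in> space M. W n \<omega> = l} \<omega> *\<^sub>R F l)"
    by (intro Bochner_Integration.integrable_sum integrable_scaleR_left)
      (simp add: random_word_event_sets emeasure_eq_measure)
  then show ?thesis
    by (rule Bochner_Integration.integrable_cong[THEN iffD2, rotated 2])
      (auto intro: random_word_function_expand)
qed

lemma borel_measurable_random_word [measurable]:
  fixes F :: "nat list \<Rightarrow> 'b::{banach, second_countable_topology}"
  shows "(\<lambda>\<omega>. F (W n \<omega>)) \<in> borel_measurable M"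
  using integrable_random_word by (rule borel_measurable_integrable)

lemma expectation_random_word:
  fixes F :: "nat list \<Rightarrow> 'b::{banach, second_countable_topology}"
  shows "(\<integral>\<omega>. F (W n \<omega>) \<partial>M) = (1 / real k) ^ n *\<^sub>R (\<Sum>l\<in>words k n. F l)"
proof -
  have "(\<integral>\<omega>. F (W n \<omega>) \<partial>M) =
      (\<integral>\<omega>. (\<Sum>l\<in>words k n. indicator {\<omega> \<in> space M. W n \<omega> = l} \<omega> *\<^sub>R F l) \<partial>M)"
    by (rule Bochner_Integration.integral_cong) (auto intro: random_word_function_expand)
  also have "\<dots> = (\<Sum>l\<in>words k n. \<integral>\<omega>. indicator {\<omega> \<in> space M. W n \<omega> = l} \<omega> *\<^sub>R F l \<partial>M)"
    by (intro Bochner_Integration.integral_sum integrable_scaleR_left)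
      (simp add: random_word_event_sets emeasure_eq_measure)
  also have "\<dots> = (\<Sum>l\<in>words k n. (1 / real k) ^ n *\<^sub>R F l)"
  proof (rule sum.cong)
    fix l assume l: "l \<in> words k n"
    have "(\<integral>\<omega>. indicator {\<omega> \<in> space M. W n \<omega> = l} \<omega> *\<^sub>R F l \<partial>M) =
        prob {\<omega> \<in> space M. W n \<omega> = l} *\<^sub>R F l"
      by (simp add: random_word_event_sets emeasure_eq_measure)
    then show "(\<integral>\<omega>. indicator {\<omega> \<in> space M. W n \<omega> = l} \<omega> *\<^sub>R F l \<partial>M) =
        (1 / real k) ^ n *\<^sub>R F l"
      using prob_random_word[OF l] by simp
  qed simp
  finally show ?thesis by (simp add: scaleR_sum_right)
qed

lemma expectation_random_word_mono:
  fixes F G :: "nat list \<Rightarrow> real"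
  assumes "\<And>l. l \<in> words k n \<Longrightarrow> F l \<le> G l"
  shows "(\<integral>\<omega>. F (W n \<omega>) \<partial>M) \<le> (\<integral>\<omega>. G (W n \<omega>) \<partial>M)"
  by (intro integral_mono integrable_random_word assms random_word_in_words)

lemma norm_expectation_random_word_le:
  fixes F :: "nat list \<Rightarrow> 'b::{banach, second_countable_topology}"
  assumes "\<And>l. l \<in> words k n \<Longrightarrow> norm (F l) \<le> B"
  shows "norm (\<integral>\<omega>. F (W n \<omega>) \<partial>M) \<le> B"
proof -
  have "norm (\<integral>\<omega>. F (W n \<omega>) \<partial>M) \<le> (\<integral>\<omega>. norm (F (W n \<omega>)) \<partial>M)"
    by (rule integral_norm_bound)
  also have "\<dots> \<le> (\<integral>\<omega>. B \<partial>M)"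
    using assms by (rule expectation_random_word_mono)
  finally show ?thesis by (simp add: prob_space)
qed

text \<open>The tower property in elementary form: given the first \<open>n\<close> letters, the
  next one is uniform. All martingale arguments below rest on this identity.\<close>

lemma expectation_random_word_Suc:
  fixes F :: "nat list \<Rightarrow> 'b::{banach, second_countable_topology}"
  shows "(\<integral>\<omega>. F (W (Suc n) \<omega>) \<partial>M) = (\<integral>\<omega>. avg k (\<lambda>a. F (W n \<omega> @ [a])) \<partial>M)"
  using expectation_random_word[of F "Suc n"]
    expectation_random_word[of "\<lambda>l. avg k (\<lambda>a. F (l @ [a]))" n]
  by (simp add: sum_words_Suc avg_def scaleR_sum_right mult.commute)

end

text \<open>By monotone convergence the series of fourth powers has finite expectation, so it
  converges almost surely and its terms tend to 0.\<close>

lemma AE_tendsto_0_of_fourth_moments: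
  fixes X :: "nat \<Rightarrow> 'a \<Rightarrow> real"
  assumes int: "\<And>n. integrable M (\<lambda>\<omega>. X n \<omega> ^ 4)"
    and le: "\<And>n. (\<integral>\<omega>. X n \<omega> ^ 4 \<partial>M) \<le> b n" and "summable b"
  shows "AE \<omega> in M. (\<lambda>n. X n \<omega>) \<longlonglongrightarrow> 0"
proof -
  have "(\<integral>\<^sup>+\<omega>. (\<Sum>n. ennreal (X n \<omega> ^ 4)) \<partial>M) = (\<Sum>n. \<integral>\<^sup>+\<omega>. ennreal (X n \<omega> ^ 4) \<partial>M)"
    by (rule nn_integral_suminf) (use int in auto)
  also have "\<dots> = (\<Sum>n. ennreal (\<integral>\<omega>. X n \<omega> ^ 4 \<partial>M))"
    by (intro suminf_cong nn_integral_eq_integral int) auto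
  also have "\<dots> \<le> (\<Sum>n. ennreal (b n))"
    by (intro suminf_le ennreal_leI le) auto
  also have "\<dots> < \<infinity>"
  proof -
    have "b n \<ge> 0" for n
      using le[of n] by (rule order_trans[rotated]) (auto intro!: integral_nonneg_AE)
    then show ?thesis using \<open>summable b\<close> by (simp add: ennreal_suminf_neq_top less_top)
  qed
  finally have "AE \<omega> in M. (\<Sum>n. ennreal (X n \<omega> ^ 4)) \<noteq> \<infinity>"
    by (intro nn_integral_noteq_infinite) (use int in auto)
  then show ?thesis
  proof eventually_elim
    case (elim \<omega>)
    have "summable (\<lambda>n. X n \<omega> ^ 4)"
      using elim by (intro summable_suminf_not_top) auto
    then have "(\<lambda>n. root 4 (X n \<omega> ^ 4)) \<longlonglongrightarrow> root 4 0"
      by (intro tendsto_real_root summable_LIMSEQ_zero)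
    moreover have "root 4 (x ^ 4) = \<bar>x\<bar>" for x :: real
      using real_root_power_cancel[of 4 "\<bar>x\<bar>"] by (simp add: power_even_abs)
    ultimately have "(\<lambda>n. \<bar>X n \<omega>\<bar>) \<longlonglongrightarrow> 0" by simp
    then show ?case by (rule tendsto_rabs_zero_cancel)
  qed
qed

subsection \<open>Martingale sums\<close>

lemma foldl_closed:
  assumes "\<And>x a. x \<in> Q \<Longrightarrow> a \<in> A \<Longrightarrow> g x a \<in> Q" "x \<in> Q" "set l \<subseteq> A"
  shows "foldl g x l \<in> Q"
  using assms(2,3) by (induction l arbitrary: x) (auto intro: assms(1))

lemma foldl_words_le:
  assumes "\<And>x a. x \<le> k \<Longrightarrow> a \<in> {1..k} \<Longrightarrow> g x a \<le> k" "l \<in> words k n"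
  shows "foldl g 0 l \<le> k"
  using foldl_closed[of "{..k}" "{1..k}" g 0 l] assms by (auto simp: words_def)

text \<open>The term linear in \<open>d\<close> is kept exact because it will average to zero. The
  cubic term is absorbed by completing a square: 4sd^3 = 2s^2d^2 + 2d^4 - 2(d(s-d))^2.\<close>

lemma fourth_power_add_le:
  fixes s d C :: real
  assumes "\<bar>d\<bar> \<le> C"
  shows "(s + d) ^ 4 \<le> s ^ 4 + (4 * s ^ 3) * d + (8 * C\<^sup>2 * s\<^sup>2 + 3 * C ^ 4)"
proof -
  have d: "d\<^sup>2 \<le> C\<^sup>2" using assms by (simp add: abs_le_square_iff[symmetric])
  have "d ^ 4 \<le> C ^ 4" using power_mono[OF d, of 2] by simp
  moreover have "s\<^sup>2 * d\<^sup>2 \<le> s\<^sup>2 * C\<^sup>2" using d by (rule mult_left_mono) simp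
  moreover have "(s + d) ^ 4 = s ^ 4 + (4 * s ^ 3) * d + 8 * (s\<^sup>2 * d\<^sup>2) + 3 * d ^ 4
      - 2 * (d * (s - d))\<^sup>2"
    by algebra
  moreover have "(d * (s - d))\<^sup>2 \<ge> 0" by simp
  moreover have "8 * C\<^sup>2 * s\<^sup>2 = 8 * (s\<^sup>2 * C\<^sup>2)" by simp
  ultimately show ?thesis by linarith
qed

section \<open>Expansion of one step of the characteristic function with cubic error\<close>

lemma norm_iexp_diff_le: "norm (iexp x - iexp y) \<le> \<bar>x - y\<bar>"
proof -
  have "iexp x = iexp y * iexp (x - y)"
    by (simp add: right_diff_distrib flip: exp_add)
  then have "iexp x - iexp y = iexp y * (iexp (x - y) - 1)"
    by (simp only: right_diff_distrib mult_1_right)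
  moreover have "norm (iexp (x - y) - 1) \<le> \<bar>x - y\<bar>"
    using iexp_approx1[of "x - y" 0] by simp
  ultimately show ?thesis by (simp add: norm_mult)
qed

lemma iexp_quadratic_remainder:
  "norm (iexp x - (1 + \<i> * of_real x - of_real (x\<^sup>2 / 2))) \<le> \<bar>x\<bar> ^ 3"
proof -
  have "norm (iexp x - (1 + \<i> * of_real x - of_real (x\<^sup>2 / 2))) \<le> \<bar>x\<bar> ^ 3 / 6"
    using iexp_approx1[of x 2]
    by (simp add: atMost_Suc numeral_2_eq_2 eval_nat_numeral algebra_simps power2_eq_square fact_numeral)
  also have "\<dots> \<le> \<bar>x\<bar> ^ 3" by simp
  finally show ?thesis .
qed

text \<open>Multiply the quadratic Taylor polynomial of the exponential by the correction factor.
  The second-order terms combine to \<open>d\<^sup>2 + u\<close>; what remains is the Taylor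
  remainder \<open>r\<close> times the factor, a cross term of order \<theta>^3 and one of order
  \<theta>^4, and these give the summands of the constant.\<close>

lemma corrected_iexp_expansion:
  fixes d u C B \<theta> :: real
  assumes d: "\<bar>d\<bar> \<le> C" and u: "\<bar>u\<bar> \<le> B" and \<theta>: "\<bar>\<theta>\<bar> \<le> 1"
  shows "norm (iexp (\<theta> * d) * of_real (1 - \<theta>\<^sup>2 * u / 2) -
      (1 + \<i> * of_real (\<theta> * d) - of_real (\<theta>\<^sup>2 * (d\<^sup>2 + u) / 2)))
    \<le> (C ^ 3 * (1 + B) + C * B + C\<^sup>2 * B) * \<bar>\<theta>\<bar> ^ 3"
proof -
  define r where "r = iexp (\<theta> * d) - (1 + \<i> * of_real (\<theta> * d) - of_real ((\<theta> * d)\<^sup>2 / 2))"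
  have nonneg: "C \<ge> 0" "B \<ge> 0" using d u by linarith+
  have \<theta>2: "\<theta>\<^sup>2 \<le> 1" using \<theta> by (simp add: abs_square_le_1)
  have \<theta>4: "\<theta> ^ 4 \<le> \<bar>\<theta>\<bar> ^ 3" 
    using power_decreasing[of 3 4 "\<bar>\<theta>\<bar>"] \<theta> by (simp add: power_even_abs)
  have d2: "d\<^sup>2 \<le> C\<^sup>2" using d nonneg by (simp add: abs_le_square_iff[symmetric])
  have r: "norm r \<le> C ^ 3 * \<bar>\<theta>\<bar> ^ 3"
  proof -
    have "norm r \<le> \<bar>\<theta> * d\<bar> ^ 3" unfolding r_def by (rule iexp_quadratic_remainder)
    also have "\<dots> = \<bar>d\<bar> ^ 3 * \<bar>\<theta>\<bar> ^ 3" by (simp add: abs_mult power_mult_distrib)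
    also have "\<dots> \<le> C ^ 3 * \<bar>\<theta>\<bar> ^ 3"
      using d by (intro mult_right_mono power_mono) auto
    finally show ?thesis .
  qed
  have "iexp (\<theta> * d) = (1 + \<i> * of_real (\<theta> * d) - of_real ((\<theta> * d)\<^sup>2 / 2)) + r"
    by (simp add: r_def)
  then have "iexp (\<theta> * d) * of_real (1 - \<theta>\<^sup>2 * u / 2) -
      (1 + \<i> * of_real (\<theta> * d) - of_real (\<theta>\<^sup>2 * (d\<^sup>2 + u) / 2)) =
      r * of_real (1 - \<theta>\<^sup>2 * u / 2) - \<i> * of_real (\<theta> ^ 3 * (d * u / 2)) +
        of_real (\<theta> ^ 4 * (d\<^sup>2 * u / 4))"
    by (simp only: of_real_mult of_real_diff of_real_add of_real_divide of_real_power
        of_real_numeral of_real_1) (simp add: field_simps power2_eq_square power3_eq_cube power4_eq_xxxx)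
  also have "norm \<dots> \<le> norm (r * of_real (1 - \<theta>\<^sup>2 * u / 2)) +
      norm (\<i> * of_real (\<theta> ^ 3 * (d * u / 2)) :: complex) +
      norm (of_real (\<theta> ^ 4 * (d\<^sup>2 * u / 4)) :: complex)"
    by (meson norm_triangle_ineq norm_triangle_ineq4 add_right_mono order_trans)
  also have "norm (r * of_real (1 - \<theta>\<^sup>2 * u / 2)) \<le> (C ^ 3 * \<bar>\<theta>\<bar> ^ 3) * (1 + B)"
  proof -
    have "\<bar>\<theta>\<^sup>2 * u\<bar> \<le> 1 * B" unfolding abs_mult using \<theta>2 u by (intro mult_mono) auto
    then have "\<bar>1 - \<theta>\<^sup>2 * u / 2\<bar> \<le> 1 + B" using nonneg by linarith
    then show ?thesis
      unfolding norm_mult norm_of_real using r nonneg by (intro mult_mono) auto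
  qed
  also have "norm (\<i> * of_real (\<theta> ^ 3 * (d * u / 2)) :: complex) \<le> \<bar>\<theta>\<bar> ^ 3 * (C * B)"
  proof -
    have "\<bar>d * u\<bar> \<le> C * B" unfolding abs_mult using d u nonneg by (intro mult_mono) auto
    then have "\<bar>d * u / 2\<bar> \<le> C * B" by (simp add: abs_divide)
    then have "\<bar>\<theta>\<bar> ^ 3 * \<bar>d * u / 2\<bar> \<le> \<bar>\<theta>\<bar> ^ 3 * (C * B)"
      by (intro mult_left_mono) auto
    then show ?thesis
      by (simp only: norm_mult norm_of_real norm_ii abs_mult power_abs mult_1)
  qed
  also have "norm (of_real (\<theta> ^ 4 * (d\<^sup>2 * u / 4)) :: complex) \<le> \<bar>\<theta>\<bar> ^ 3 * (C\<^sup>2 * B)"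
  proof -
    have "\<bar>d\<^sup>2 * u\<bar> \<le> C\<^sup>2 * B" unfolding abs_mult using d2 u nonneg by (intro mult_mono) auto
    then have "\<bar>d\<^sup>2 * u / 4\<bar> \<le> C\<^sup>2 * B" by (simp add: abs_divide)
    then have "\<bar>\<theta> ^ 4\<bar> * \<bar>d\<^sup>2 * u / 4\<bar> \<le> \<bar>\<theta>\<bar> ^ 3 * (C\<^sup>2 * B)"
      using \<theta>4 nonneg by (intro mult_mono) auto
    then show ?thesis by (simp only: norm_of_real abs_mult)
  qed
  finally show ?thesis by (simp add: algebra_simps)
qed

text \<open>Averaging removes the linear term by \<open>mean0\<close>, and the Poisson equation
  turns the mean of \<open>d\<^sup>2 + U\<close> into \<open>s2 + u\<close>. Then 1 - \<theta>^2 (s2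
  + u)/2 factors into the stated product up to \<theta>^4 s2 u/4.\<close>

lemma corrected_average_expansion:
  fixes d U :: "nat \<Rightarrow> real" and u s2 C B \<theta> :: real
  assumes k: "k \<ge> 1"
    and d: "\<And>a. a \<in> {1..k} \<Longrightarrow> \<bar>d a\<bar> \<le> C" and U: "\<And>a. a \<in> {1..k} \<Longrightarrow> \<bar>U a\<bar> \<le> B"
    and mean0: "avg k d = 0" and poisson: "u - avg k U = avg k (\<lambda>a. (d a)\<^sup>2) - s2"
    and u: "\<bar>u\<bar> \<le> B" and \<theta>: "\<bar>\<theta>\<bar> \<le> 1" and s2: "s2 \<ge> 0"
  shows "norm (avg k (\<lambda>a. iexp (\<theta> * d a) * of_real (1 - \<theta>\<^sup>2 * U a / 2)) -
      of_real ((1 - \<theta>\<^sup>2 * s2 / 2) * (1 - \<theta>\<^sup>2 * u / 2)))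
    \<le> (C ^ 3 * (1 + B) + C * B + C\<^sup>2 * B + s2 * B) * \<bar>\<theta>\<bar> ^ 3"
proof -
  define E where "E a = iexp (\<theta> * d a) * of_real (1 - \<theta>\<^sup>2 * U a / 2)" for a
  define P where "P a = 1 + \<i> * of_real (\<theta> * d a) - of_real (\<theta>\<^sup>2 * ((d a)\<^sup>2 + U a) / 2)" for a
  have "B \<ge> 0" using u by linarith
  have \<theta>4: "\<theta> ^ 4 \<le> \<bar>\<theta>\<bar> ^ 3" 
    using power_decreasing[of 3 4 "\<bar>\<theta>\<bar>"] \<theta> by (simp add: power_even_abs)
  have EP: "norm (avg k E - avg k P) \<le> (C ^ 3 * (1 + B) + C * B + C\<^sup>2 * B) * \<bar>\<theta>\<bar> ^ 3"
    unfolding avg_diff[symmetric] E_def P_def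
    using k by (intro norm_avg_le corrected_iexp_expansion d U \<theta>)
  have "avg k P = 1 + \<i> * of_real \<theta> * of_real (avg k d) -
      of_real (\<theta>\<^sup>2 / 2) * of_real (avg k (\<lambda>a. (d a)\<^sup>2) + avg k U)"
    unfolding of_real_avg avg_add[symmetric] avg_mult_left[symmetric] P_def
    using avg_const[OF k, of "1 :: complex"]
    by (simp add: avg_diff avg_add avg_mult_left[symmetric] mult.assoc)
  also have "\<dots> = of_real ((1 - \<theta>\<^sup>2 * s2 / 2) * (1 - \<theta>\<^sup>2 * u / 2)) - of_real (\<theta> ^ 4 * (s2 * u / 4))"
  proof -
    have "avg k (\<lambda>a. (d a)\<^sup>2) + avg k U = s2 + u" using poisson by simp
    moreover have "1 - \<theta>\<^sup>2 / 2 * (s2 + u) =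
        (1 - \<theta>\<^sup>2 * s2 / 2) * (1 - \<theta>\<^sup>2 * u / 2) - \<theta> ^ 4 * (s2 * u / 4)"
      by (simp add: field_simps power2_eq_square power4_eq_xxxx)
    then have "of_real (1 - \<theta>\<^sup>2 / 2 * (s2 + u)) = (of_real ((1 - \<theta>\<^sup>2 * s2 / 2) *
        (1 - \<theta>\<^sup>2 * u / 2) - \<theta> ^ 4 * (s2 * u / 4)) :: complex)"
      by (simp only:)
    ultimately show ?thesis
      by (simp only: mean0 of_real_diff of_real_mult of_real_1 of_real_0 mult_zero_right add_0_right)
  qed
  finally have P: "avg k P - of_real ((1 - \<theta>\<^sup>2 * s2 / 2) * (1 - \<theta>\<^sup>2 * u / 2)) =
      - of_real (\<theta> ^ 4 * (s2 * u / 4))"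
    by simp
  have "\<bar>\<theta> ^ 4\<bar> * \<bar>s2 * u / 4\<bar> \<le> \<bar>\<theta>\<bar> ^ 3 * (s2 * B)"
  proof -
    have "\<bar>s2 * u\<bar> \<le> s2 * B" unfolding abs_mult using u s2 by (intro mult_mono) auto
    then have "\<bar>s2 * u / 4\<bar> \<le> s2 * B" by (simp add: abs_divide)
    then show ?thesis using \<theta>4 s2 \<open>B \<ge> 0\<close> by (intro mult_mono) auto
  qed
  then have "norm (avg k P - of_real ((1 - \<theta>\<^sup>2 * s2 / 2) * (1 - \<theta>\<^sup>2 * u / 2))) \<le> s2 * B * \<bar>\<theta>\<bar> ^ 3"
    unfolding P norm_minus_cancel norm_of_real abs_mult[symmetric] by (simp add: mult.commute)
  then have "norm ((avg k E - avg k P) +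
      (avg k P - of_real ((1 - \<theta>\<^sup>2 * s2 / 2) * (1 - \<theta>\<^sup>2 * u / 2))))
      \<le> (C ^ 3 * (1 + B) + C * B + C\<^sup>2 * B) * \<bar>\<theta>\<bar> ^ 3 + s2 * B * \<bar>\<theta>\<bar> ^ 3"
    using EP by (intro order_trans[OF norm_triangle_ineq] add_mono)
  then have "norm (avg k E - of_real ((1 - \<theta>\<^sup>2 * s2 / 2) * (1 - \<theta>\<^sup>2 * u / 2)))
      \<le> (C ^ 3 * (1 + B) + C * B + C\<^sup>2 * B + s2 * B) * \<bar>\<theta>\<bar> ^ 3"
    by (simp add: algebra_simps)
  then show ?thesis by (simp only: E_def[abs_def])
qed

lemma bounded_on_atMost:
  fixes v :: "nat \<Rightarrow> real"
  obtains B where "\<And>x. x \<le> k \<Longrightarrow> \<bar>v x\<bar> \<le> B"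
proof
  fix x assume "x \<le> k"
  then show "\<bar>v x\<bar> \<le> (\<Sum>x\<le>k. \<bar>v x\<bar>)"
    by (intro member_le_sum) auto
qed

section \<open>Moment bounds and the law of large numbers for martingale sums\<close>

context uniform_letters
begin

context
  fixes g :: "nat \<Rightarrow> nat \<Rightarrow> nat" and D :: "nat \<Rightarrow> nat \<Rightarrow> real" and C :: real
  assumes closed: "\<And>x a. x \<le> k \<Longrightarrow> a \<in> {1..k} \<Longrightarrow> g x a \<le> k"
    and mean0: "\<And>x. x \<le> k \<Longrightarrow> avg k (D x) = 0"
    and bounded: "\<And>x a. x \<le> k \<Longrightarrow> a \<in> {1..k} \<Longrightarrow> \<bar>D x a\<bar> \<le> C"
begin

abbreviation "S \<equiv> chain_sum g D 0"
abbreviation "X \<equiv> foldl g 0"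

lemma state_le: "l \<in> words k n \<Longrightarrow> X l \<le> k"
  by (rule foldl_words_le[OF closed])

text \<open>Orthogonality of martingale differences: given the past, the cross term
  \<open>2 * S l * D (X l) a\<close> averages to zero, so each step adds at most
  \<open>C\<^sup>2\<close>.\<close>

lemma second_moment_le: "(\<integral>\<omega>. (S (W n \<omega>))\<^sup>2 \<partial>M) \<le> C\<^sup>2 * real n"
proof (induction n)
  case 0
  then show ?case by (simp add: random_word_def)
next
  case (Suc n)
  have "(\<integral>\<omega>. (S (W (Suc n) \<omega>))\<^sup>2 \<partial>M) = (\<integral>\<omega>. avg k (\<lambda>a. (S (W n \<omega> @ [a]))\<^sup>2) \<partial>M)"
    by (rule expectation_random_word_Suc)
  also have "\<dots> \<le> (\<integral>\<omega>. (S (W n \<omega>))\<^sup>2 + C\<^sup>2 \<partial>M)"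
  proof (rule expectation_random_word_mono)
    fix l assume "l \<in> words k n"
    then have x: "X l \<le> k" by (rule state_le)
    have "avg k (\<lambda>a. (S (l @ [a]))\<^sup>2) \<le> avg k (\<lambda>a. ((S l)\<^sup>2 + C\<^sup>2) + (2 * S l) * D (X l) a)"
    proof (rule avg_mono)
      fix a assume "a \<in> {1..k}"
      then have "\<bar>D (X l) a\<bar> \<le> C" using x by (intro bounded)
      then have "(D (X l) a)\<^sup>2 \<le> C\<^sup>2" by (simp add: abs_le_square_iff[symmetric])
      then show "(S (l @ [a]))\<^sup>2 \<le> ((S l)\<^sup>2 + C\<^sup>2) + (2 * S l) * D (X l) a"
        by (simp add: chain_sum_snoc power2_sum)
    qed
    also have "\<dots> = (S l)\<^sup>2 + C\<^sup>2"
      unfolding avg_add avg_mult_left by (simp add: mean0[OF x] avg_const[OF k_pos])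
    finally show "avg k (\<lambda>a. (S (l @ [a]))\<^sup>2) \<le> (S l)\<^sup>2 + C\<^sup>2" .
  qed
  also have "\<dots> = (\<integral>\<omega>. (S (W n \<omega>))\<^sup>2 \<partial>M) + C\<^sup>2"
    by (subst Bochner_Integration.integral_add)
      (auto simp: prob_space integrable_random_word[of "\<lambda>l. (S l)\<^sup>2"])
  finally show ?case using Suc by (simp add: algebra_simps)
qed

text \<open>Once the linear term has averaged out, one step adds a multiple of the second moment,
  which is O(n); summation gives order n^2.\<close>

lemma fourth_moment_le: "(\<integral>\<omega>. (S (W n \<omega>)) ^ 4 \<partial>M) \<le> 8 * C ^ 4 * (real n)\<^sup>2"
proof (induction n)
  case 0
  then show ?case by (simp add: random_word_def)
next
  case (Suc n)
  have "(\<integral>\<omega>. (S (W (Suc n) \<omega>)) ^ 4 \<partial>M) = (\<integral>\<omega>. avg k (\<lambda>a. (S (W n \<omega> @ [a])) ^ 4) \<partial>M)"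
    by (rule expectation_random_word_Suc)
  also have "\<dots> \<le> (\<integral>\<omega>. (S (W n \<omega>)) ^ 4 + (8 * C\<^sup>2 * (S (W n \<omega>))\<^sup>2 + 3 * C ^ 4) \<partial>M)"
  proof (rule expectation_random_word_mono)
    fix l assume "l \<in> words k n"
    then have x: "X l \<le> k" by (rule state_le)
    have "avg k (\<lambda>a. (S (l @ [a])) ^ 4) \<le>
        avg k (\<lambda>a. (S l) ^ 4 + (4 * (S l) ^ 3) * D (X l) a + (8 * C\<^sup>2 * (S l)\<^sup>2 + 3 * C ^ 4))"
      unfolding chain_sum_snoc using x by (intro avg_mono fourth_power_add_le bounded)
    also have "\<dots> = (S l) ^ 4 + (8 * C\<^sup>2 * (S l)\<^sup>2 + 3 * C ^ 4)"
      unfolding avg_add[of k "\<lambda>a. S l ^ 4 + (4 * (S l) ^ 3) * D (X l) a"]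
        avg_add[of k "\<lambda>a. S l ^ 4"] avg_mult_left
      by (simp add: mean0[OF x] avg_const[OF k_pos])
    finally show "avg k (\<lambda>a. (S (l @ [a])) ^ 4) \<le>
      (S l) ^ 4 + (8 * C\<^sup>2 * (S l)\<^sup>2 + 3 * C ^ 4)" .
  qed
  also have "\<dots> = (\<integral>\<omega>. (S (W n \<omega>)) ^ 4 \<partial>M) + (8 * C\<^sup>2 * (\<integral>\<omega>. (S (W n \<omega>))\<^sup>2 \<partial>M) + 3 * C ^ 4)"
    by (simp add: prob_space integrable_random_word[of "\<lambda>l. (S l)\<^sup>2"]
        integrable_random_word[of "\<lambda>l. (S l) ^ 4"])
  also have "\<dots> \<le> 8 * C ^ 4 * (real n)\<^sup>2 + (8 * C\<^sup>2 * (C\<^sup>2 * real n) + 3 * C ^ 4)"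
    using Suc second_moment_le[of n] by (intro add_mono mult_left_mono) auto
  also have "\<dots> = C ^ 4 * (8 * (real n)\<^sup>2 + 8 * real n + 3)"
    by (simp add: algebra_simps power2_eq_square power4_eq_xxxx)
  \<comment> \<open>Here 8(n+1)^2 = 8n^2 + 16n + 8 leaves room for 8n + 3.\<close>
  also have "\<dots> \<le> C ^ 4 * (8 * (real (Suc n))\<^sup>2)"
    by (intro mult_left_mono) (auto simp: power2_eq_square algebra_simps)
  finally show ?case by (simp add: mult.commute mult.left_commute)
qed

text \<open>After division by n^4 the fourth moments are O(1/n^2), which is summable; second moments
  would yield only 1/n.\<close>

lemma AE_average_tendsto_0: "AE \<omega> in M. (\<lambda>n. S (W n \<omega>) / real n) \<longlonglongrightarrow> 0"
proof (rule AE_tendsto_0_of_fourth_moments)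
  show "integrable M (\<lambda>\<omega>. (S (W n \<omega>) / real n) ^ 4)" for n
    by (rule integrable_random_word)
  show "(\<integral>\<omega>. (S (W n \<omega>) / real n) ^ 4 \<partial>M) \<le> 8 * C ^ 4 * (inverse (real n ^ 2))" for n
  \<comment> \<open>At \<open>n = 0\<close> both sides are 0, since division by zero yields
    0.\<close>
  proof (cases "n = 0")
    case False
    have "(\<integral>\<omega>. (S (W n \<omega>) / real n) ^ 4 \<partial>M) = (\<integral>\<omega>. (S (W n \<omega>)) ^ 4 \<partial>M) / real n ^ 4"
      by (simp add: power_divide)
    also have "\<dots> \<le> (8 * C ^ 4 * (real n)\<^sup>2) / real n ^ 4"
      by (intro divide_right_mono fourth_moment_le) simp
    also have "\<dots> = 8 * C ^ 4 * (inverse (real n ^ 2))"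
      using False by (simp add: field_simps power2_eq_square power4_eq_xxxx)
    finally show ?thesis .
  qed simp
  show "summable (\<lambda>n. 8 * C ^ 4 * inverse (real n ^ 2))"
    by (intro summable_mult inverse_power_summable) simp
qed

section \<open>Convergence of characteristic functions by variance correction\<close>

context
  fixes U :: "nat \<Rightarrow> real" and s2 B :: real
  assumes poisson: "\<And>x. x \<le> k \<Longrightarrow> U x - avg k (\<lambda>a. U (g x a)) = avg k (\<lambda>a. (D x a)\<^sup>2) - s2"
    and U_bounded: "\<And>x. x \<le> k \<Longrightarrow> \<bar>U x\<bar> \<le> B"
    and s2_pos: "s2 > 0"
begin

text \<open>The factor \<open>1 - \<theta>\<^sup>2 U / 2\<close> replaces the conditional variance of each step by the constant
  \<open>s2\<close>, up to an error of order \<open>\<theta>\<^sup>3\<close>.\<close>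

definition corrected_char :: "real \<Rightarrow> nat \<Rightarrow> complex" where
  "corrected_char \<theta> n = (\<integral>\<omega>. iexp (\<theta> * S (W n \<omega>)) * of_real (1 - \<theta>\<^sup>2 * U (X (W n \<omega>)) / 2) \<partial>M)"

definition error_const :: real where
  "error_const = C ^ 3 * (1 + B) + C * B + C\<^sup>2 * B + s2 * B"

text \<open>Given the first \<open>n\<close> letters, the factor
  \<open>iexp (\<theta> * S l)\<close> has modulus one and comes out of the average, which leaves
  the one-step expansion at the state \<open>X l\<close>.\<close>

lemma corrected_char_Suc:
  assumes "\<bar>\<theta>\<bar> \<le> 1"
  shows "norm (corrected_char \<theta> (Suc n) - of_real (1 - \<theta>\<^sup>2 * s2 / 2) * corrected_char \<theta> n)
    \<le> error_const * \<bar>\<theta>\<bar> ^ 3"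
proof -
  define Y where "Y l = iexp (\<theta> * S l) * of_real (1 - \<theta>\<^sup>2 * U (X l) / 2)" for l
  define c :: complex where "c = of_real (1 - \<theta>\<^sup>2 * s2 / 2)"
  have "corrected_char \<theta> (Suc n) - c * corrected_char \<theta> n =
      (\<integral>\<omega>. avg k (\<lambda>a. Y (W n \<omega> @ [a])) \<partial>M) - (\<integral>\<omega>. c * Y (W n \<omega>) \<partial>M)"
    unfolding corrected_char_def Y_def[symmetric] expectation_random_word_Suc[of Y] by simp
  also have "\<dots> = (\<integral>\<omega>. avg k (\<lambda>a. Y (W n \<omega> @ [a])) - c * Y (W n \<omega>) \<partial>M)"
    by (rule Bochner_Integration.integral_diff[symmetric])
      (rule integrable_random_word[of "\<lambda>l. avg k (\<lambda>a. Y (l @ [a]))"]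
        integrable_random_word[of "\<lambda>l. c * Y l"])+
  also have "norm \<dots> \<le> error_const * \<bar>\<theta>\<bar> ^ 3"
  proof (rule norm_expectation_random_word_le)
    fix l assume "l \<in> words k n"
    then have x: "X l \<le> k" by (rule state_le)
    define E where "E a = iexp (\<theta> * D (X l) a) * of_real (1 - \<theta>\<^sup>2 * U (g (X l) a) / 2)" for a
    have "Y (l @ [a]) = iexp (\<theta> * S l) * E a" for a
      by (simp add: Y_def E_def chain_sum_snoc distrib_left exp_add mult.assoc)
    then have "avg k (\<lambda>a. Y (l @ [a])) = iexp (\<theta> * S l) * avg k E"
      by (simp only: avg_mult_left)
    moreover have "c * Y l =
        iexp (\<theta> * S l) * of_real ((1 - \<theta>\<^sup>2 * s2 / 2) * (1 - \<theta>\<^sup>2 * U (X l) / 2))"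
      by (simp add: Y_def c_def)
    ultimately have "avg k (\<lambda>a. Y (l @ [a])) - c * Y l =
        iexp (\<theta> * S l) * (avg k E - of_real ((1 - \<theta>\<^sup>2 * s2 / 2) * (1 - \<theta>\<^sup>2 * U (X l) / 2)))"
      by (simp only: right_diff_distrib)
    moreover have "norm (avg k E - of_real ((1 - \<theta>\<^sup>2 * s2 / 2) * (1 - \<theta>\<^sup>2 * U (X l) / 2)))
        \<le> error_const * \<bar>\<theta>\<bar> ^ 3"
      unfolding E_def error_const_def using assms x s2_pos k_pos
      by (intro corrected_average_expansion bounded U_bounded closed mean0 poisson) auto
    ultimately show "norm (avg k (\<lambda>a. Y (l @ [a])) - c * Y l) \<le> error_const * \<bar>\<theta>\<bar> ^ 3"
      by (simp add: norm_mult)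
  qed
  finally show ?thesis by (simp add: c_def)
qed

text \<open>The multiplier has modulus at most one, so the one-step errors add up without being
  amplified.\<close>

lemma corrected_char_approx:
  assumes "\<bar>\<theta>\<bar> \<le> 1" "\<bar>1 - \<theta>\<^sup>2 * s2 / 2\<bar> \<le> 1"
  shows "norm (corrected_char \<theta> n - of_real ((1 - \<theta>\<^sup>2 * s2 / 2) ^ n) * corrected_char \<theta> 0)
    \<le> real n * (error_const * \<bar>\<theta>\<bar> ^ 3)"
proof (induction n)
  case (Suc n)
  define q where "q = 1 - \<theta>\<^sup>2 * s2 / 2"
  have "corrected_char \<theta> (Suc n) - of_real (q ^ Suc n) * corrected_char \<theta> 0 =
      (corrected_char \<theta> (Suc n) - of_real q * corrected_char \<theta> n) +
      of_real q * (corrected_char \<theta> n - of_real (q ^ n) * corrected_char \<theta> 0)"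
    by (simp add: algebra_simps)
  also have "norm \<dots> \<le> error_const * \<bar>\<theta>\<bar> ^ 3 + 1 * (real n * (error_const * \<bar>\<theta>\<bar> ^ 3))"
  proof (intro order_trans[OF norm_triangle_ineq] add_mono)
    show "norm (of_real q * (corrected_char \<theta> n - of_real (q ^ n) * corrected_char \<theta> 0))
        \<le> 1 * (real n * (error_const * \<bar>\<theta>\<bar> ^ 3))"
      unfolding norm_mult norm_of_real
      using Suc assms(2) unfolding q_def[symmetric] by (intro mult_mono) auto
  qed (use corrected_char_Suc[OF assms(1), of n] in \<open>simp add: q_def\<close>)
  finally show ?case by (simp add: q_def algebra_simps)
qed simp

lemma norm_corrected_char_diff_le:
  "norm ((\<integral>\<omega>. iexp (\<theta> * S (W n \<omega>)) \<partial>M) - corrected_char \<theta> n) \<le> \<theta>\<^sup>2 * B"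
proof -
  define Y where "Y l = iexp (\<theta> * S l) * of_real (1 - \<theta>\<^sup>2 * U (X l) / 2)" for l
  have "(\<integral>\<omega>. iexp (\<theta> * S (W n \<omega>)) \<partial>M) - corrected_char \<theta> n =
      (\<integral>\<omega>. iexp (\<theta> * S (W n \<omega>)) - Y (W n \<omega>) \<partial>M)"
    unfolding corrected_char_def Y_def[symmetric]
    by (rule Bochner_Integration.integral_diff[symmetric])
      (rule integrable_random_word[of "\<lambda>l. iexp (\<theta> * S l)"] integrable_random_word[of Y])+
  also have "norm \<dots> \<le> \<theta>\<^sup>2 * B"
  proof (rule norm_expectation_random_word_le)
    fix l assume "l \<in> words k n"
    then have U: "\<bar>U (X l)\<bar> \<le> B" by (intro U_bounded state_le)
    have "iexp (\<theta> * S l) - Y l = iexp (\<theta> * S l) * of_real (\<theta>\<^sup>2 * U (X l) / 2)"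
      by (simp add: Y_def algebra_simps)
    also have "norm \<dots> = \<theta>\<^sup>2 * (\<bar>U (X l)\<bar> / 2)"
      by (simp add: norm_mult norm_divide norm_power abs_mult)
    also have "\<dots> \<le> \<theta>\<^sup>2 * B"
      using U by (intro mult_left_mono) auto
    finally show "norm (iexp (\<theta> * S l) - Y l) \<le> \<theta>\<^sup>2 * B" .
  qed
  finally show ?thesis .
qed

text \<open>With \<theta> of order n^(-1/2), the multiplier is 1 - t^2/(2n), whose n-th power tends
  to exp(-t^2/2). The accumulated error n |\<theta>|^3 and the cost \<theta>^2 B of dropping the
  correction both vanish.\<close>

lemma char_tendsto:
  "(\<lambda>n. \<integral>\<omega>. iexp (t / sqrt (s2 * real n) * S (W n \<omega>)) \<partial>M) \<longlonglongrightarrow> of_real (exp (- (t\<^sup>2) / 2))"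
proof -
  define \<theta> where "\<theta> n = t / sqrt (s2 * real n)" for n
  have \<theta>_lim: "\<theta> \<longlonglongrightarrow> 0"
  proof -
    have "(\<lambda>n. t / sqrt s2 * (1 / sqrt (real n))) \<longlonglongrightarrow> t / sqrt s2 * 0"
      by (intro tendsto_mult tendsto_const) real_asymp
    then show ?thesis by (simp add: \<theta>_def[abs_def] real_sqrt_mult)
  qed
  have \<theta>2: "(\<theta> n)\<^sup>2 * s2 / 2 = t\<^sup>2 / 2 / real n" for n
    using s2_pos by (simp add: \<theta>_def power_divide)
  have pow: "(\<lambda>n. (1 - (\<theta> n)\<^sup>2 * s2 / 2) ^ n) \<longlonglongrightarrow> exp (- (t\<^sup>2) / 2)"
    using tendsto_exp_limit_sequentially[of "- (t\<^sup>2) / 2"] by (simp add: \<theta>2)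
  have c0: "(\<lambda>n. corrected_char (\<theta> n) 0) \<longlonglongrightarrow> of_real (1 - 0\<^sup>2 * U 0 / 2)"
  proof -
    have "corrected_char \<eta> 0 = of_real (1 - \<eta>\<^sup>2 * U 0 / 2)" for \<eta>
      by (simp add: corrected_char_def random_word_def prob_space)
    then show ?thesis
      by (simp only:) (intro tendsto_intros \<theta>_lim, simp)
  qed
  have "(\<lambda>n. of_real ((1 - (\<theta> n)\<^sup>2 * s2 / 2) ^ n) * corrected_char (\<theta> n) 0)
      \<longlonglongrightarrow> of_real (exp (- (t\<^sup>2) / 2)) * of_real (1 - 0\<^sup>2 * U 0 / 2)"
    by (intro tendsto_mult tendsto_of_real pow c0)
  then have main: "(\<lambda>n. of_real ((1 - (\<theta> n)\<^sup>2 * s2 / 2) ^ n) * corrected_char (\<theta> n) 0)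
      \<longlonglongrightarrow> of_real (exp (- (t\<^sup>2) / 2))"
    by simp
  have "(\<lambda>n. real n * (error_const * \<bar>\<theta> n\<bar> ^ 3)) \<longlonglongrightarrow> 0"
  proof -
    have "(\<lambda>n. error_const * (\<bar>t\<bar> / sqrt s2) ^ 3 * (real n * (1 / sqrt (real n)) ^ 3))
        \<longlonglongrightarrow> error_const * (\<bar>t\<bar> / sqrt s2) ^ 3 * 0"
      by (intro tendsto_mult tendsto_const) real_asymp
    moreover have "\<bar>\<theta> n\<bar> = \<bar>t\<bar> / sqrt s2 * (1 / sqrt (real n))" for n
      using s2_pos by (simp add: \<theta>_def abs_divide real_sqrt_mult abs_mult)
    ultimately show ?thesis
      by (simp only: power_mult_distrib mult_ac mult_zero_right mult_zero_left)
  qed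
  moreover have "(\<lambda>n. (\<theta> n)\<^sup>2 * B) \<longlonglongrightarrow> 0\<^sup>2 * B"
    by (intro tendsto_intros \<theta>_lim)
  ultimately have err: "(\<lambda>n. (\<theta> n)\<^sup>2 * B + real n * (error_const * \<bar>\<theta> n\<bar> ^ 3)) \<longlonglongrightarrow> 0"
    using tendsto_add[of "\<lambda>n. (\<theta> n)\<^sup>2 * B"] by fastforce
  \<comment> \<open>The side conditions of \<open>corrected_char_approx\<close> hold only for large
    \<open>n\<close>.\<close>
  have small: "eventually (\<lambda>n. \<bar>\<theta> n\<bar> \<le> 1 \<and> \<bar>1 - (\<theta> n)\<^sup>2 * s2 / 2\<bar> \<le> 1) sequentially"
  proof -
    have "(\<lambda>n. (\<theta> n)\<^sup>2 * s2 / 2) \<longlonglongrightarrow> 0\<^sup>2 * s2 / 2" by (intro tendsto_intros \<theta>_lim) simp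
    then have "eventually (\<lambda>n. (\<theta> n)\<^sup>2 * s2 / 2 < 1) sequentially"
      by (rule order_tendstoD) simp
    moreover have "eventually (\<lambda>n. \<bar>\<theta> n\<bar> < 1) sequentially"
      using tendsto_rabs_zero[OF \<theta>_lim] by (rule order_tendstoD) simp
    ultimately show ?thesis
    proof eventually_elim
      case (elim n)
      moreover have "(\<theta> n)\<^sup>2 * s2 / 2 \<ge> 0" using s2_pos by simp
      ultimately show ?case by linarith
    qed
  qed
  have "(\<lambda>n. (\<integral>\<omega>. iexp (\<theta> n * S (W n \<omega>)) \<partial>M) -
      of_real ((1 - (\<theta> n)\<^sup>2 * s2 / 2) ^ n) * corrected_char (\<theta> n) 0) \<longlonglongrightarrow> 0"
  proof (rule Lim_null_comparison[OF _ err])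
    show "eventually (\<lambda>n. norm ((\<integral>\<omega>. iexp (\<theta> n * S (W n \<omega>)) \<partial>M) -
        of_real ((1 - (\<theta> n)\<^sup>2 * s2 / 2) ^ n) * corrected_char (\<theta> n) 0)
        \<le> (\<theta> n)\<^sup>2 * B + real n * (error_const * \<bar>\<theta> n\<bar> ^ 3)) sequentially"
      using small
    proof eventually_elim
      case (elim n)
      then show ?case
        by (intro norm_diff_triangle_le[OF norm_corrected_char_diff_le corrected_char_approx]) auto
    qed
  qed
  from tendsto_add[OF this main] show ?thesis by (simp add: \<theta>_def)
qed

end

end

end

subsection \<open>Additive functionals of chains driven by uniform letters\<close>

text \<open>The differences of \<open>f\<close> along the path telescope, so passing to the
  corrected step costs only boundary terms.\<close>

lemma chain_sum_telescope:
  "chain_sum g (\<lambda>x a. h x a - m + f (g x a) - f x) x l =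
    chain_sum g h x l - m * real (length l) + f (foldl g x l) - f x"
  by (induction l arbitrary: x) (auto simp: algebra_simps)

text \<open>Centring by \<open>avg k v\<close> for every \<open>v\<close> forces any stationary law
  on the states up to \<open>k\<close> to be uniform on \<open>{1..k}\<close>. The equation is also
  demanded at the initial state \<open>0\<close>, which that average omits.\<close>

locale letter_chain = uniform_letters M k w for M :: "'a measure" and k w +
  fixes g :: "nat \<Rightarrow> nat \<Rightarrow> nat"
  assumes closed: "\<And>x a. x \<le> k \<Longrightarrow> a \<in> {1..k} \<Longrightarrow> g x a \<le> k"
    and poisson_solvable:
      "\<And>v. \<exists>u :: nat \<Rightarrow> real. \<forall>x\<le>k. u x - avg k (\<lambda>a. u (g x a)) = v x - avg k v"
begin

lemma additive_functional_limits:
  fixes h :: "nat \<Rightarrow> nat \<Rightarrow> real" and R :: "nat list \<Rightarrow> real" and m :: real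
  assumes R: "\<And>l. l \<noteq> [] \<Longrightarrow> set l \<subseteq> {1..k} \<Longrightarrow> R l = chain_sum g h 0 l"
    and m: "m = avg k (\<lambda>x. avg k (h x))"
    and nondeg: "x0 \<in> {1..k}" "a0 \<in> {1..k}" "g x0 a0 = x0" "h x0 a0 \<noteq> m"
  shows "AE \<omega> in M. (\<lambda>n. R (W n \<omega>) / real n) \<longlonglongrightarrow> m"
    and "\<exists>\<sigma>>0. weak_conv_m
      (\<lambda>n. distr M borel (\<lambda>\<omega>. (R (W n \<omega>) - m * real n) / (\<sigma> * sqrt (real n))))
      std_normal_distribution"
proof -
  obtain f where f: "\<And>x. x \<le> k \<Longrightarrow> f x - avg k (\<lambda>a. f (g x a)) = avg k (h x) - m"
    using poisson_solvable[of "\<lambda>x. avg k (h x)"] unfolding m by blast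
  \<comment> \<open>The increment of \<open>f\<close> cancels the dependence of the mean of
    \<open>h\<close> on the state, which makes \<open>D\<close> a martingale difference.\<close>
  define D where "D x a = h x a - m + f (g x a) - f x" for x a
  define s2 where "s2 = avg k (\<lambda>x. avg k (\<lambda>a. (D x a)\<^sup>2))"
  obtain U where U: "\<And>x. x \<le> k \<Longrightarrow> U x - avg k (\<lambda>a. U (g x a)) = avg k (\<lambda>a. (D x a)\<^sup>2) - s2"
    using poisson_solvable[of "\<lambda>x. avg k (\<lambda>a. (D x a)\<^sup>2)"] unfolding s2_def by blast
  obtain B where B: "\<And>x. x \<le> k \<Longrightarrow> \<bar>U x\<bar> \<le> B"
    using bounded_on_atMost[of k U] by blast
  obtain F where F: "\<And>x. x \<le> k \<Longrightarrow> \<bar>f x\<bar> \<le> F"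
    using bounded_on_atMost[of k f] by blast
  define C where "C = (\<Sum>x\<le>k. \<Sum>a\<in>{1..k}. \<bar>D x a\<bar>)"
  have bounded: "\<bar>D x a\<bar> \<le> C" if "x \<le> k" "a \<in> {1..k}" for x a
  proof -
    have "\<bar>D x a\<bar> \<le> (\<Sum>a\<in>{1..k}. \<bar>D x a\<bar>)"
      using that by (intro member_le_sum) auto
    also have "\<dots> \<le> C"
      unfolding C_def using that by (intro member_le_sum[of x "{..k}"]) (auto intro: sum_nonneg)
    finally show ?thesis .
  qed
  have mean0: "avg k (D x) = 0" if "x \<le> k" for x
    using f[OF that]
    by (simp add: D_def[abs_def] avg_diff avg_add avg_const[OF k_pos])
  have s2_pos: "s2 > 0"
  proof -
    \<comment> \<open>Since \<open>a0\<close> fixes \<open>x0\<close>, the \<open>f\<close> terms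
      cancel and \<open>D x0 a0 = h x0 a0 - m\<close>. One positive square makes the whole average
      positive.\<close>
    have "(D x0 a0)\<^sup>2 > 0" using nondeg by (simp add: D_def)
    then have "(\<Sum>a=1..k. (D x0 a)\<^sup>2) > 0"
      using nondeg by (intro sum_pos2[of _ a0]) auto
    then have "avg k (\<lambda>a. (D x0 a)\<^sup>2) > 0" using k_pos by (simp add: avg_def)
    then have "(\<Sum>x=1..k. avg k (\<lambda>a. (D x a)\<^sup>2)) > 0"
      using nondeg by (intro sum_pos2[of _ x0]) (auto simp: avg_def sum_nonneg)
    then show ?thesis using k_pos by (simp add: s2_def avg_def[of k "\<lambda>x. avg k (\<lambda>a. (D x a)\<^sup>2)"])
  qed
  \<comment> \<open>Only \<open>f\<close> at the final and the initial state survives, so the bound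
    \<open>2 * F\<close> is uniform in \<open>n\<close>.\<close>
  have diff: "\<bar>R l - m * real n - chain_sum g D 0 l\<bar> \<le> 2 * F" if "n \<ge> 1" "l \<in> words k n" for n l
  proof -
    have "foldl g 0 l \<le> k" using closed that(2) by (rule foldl_words_le)
    then have "\<bar>f (foldl g 0 l)\<bar> \<le> F" "\<bar>f 0\<bar> \<le> F" by (auto intro: F)
    moreover have "chain_sum g D 0 l = R l - m * real n + f (foldl g 0 l) - f 0"
    proof -
      have "l \<noteq> []" "set l \<subseteq> {1..k}" "length l = n" using that by (auto simp: words_def)
      then show ?thesis by (simp add: D_def[abs_def] chain_sum_telescope R)
    qed
    ultimately show ?thesis by linarith
  qed

  have "AE \<omega> in M. (\<lambda>n. chain_sum g D 0 (W n \<omega>) / real n) \<longlonglongrightarrow> 0"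
    using closed mean0 bounded by (rule AE_average_tendsto_0)
  then show "AE \<omega> in M. (\<lambda>n. R (W n \<omega>) / real n) \<longlonglongrightarrow> m"
    using AE_space
  proof eventually_elim
    case (elim \<omega>)
    have "(\<lambda>n. R (W n \<omega>) / real n - m - chain_sum g D 0 (W n \<omega>) / real n) \<longlonglongrightarrow> 0"
    proof (rule Lim_null_comparison)
      show "eventually (\<lambda>n. norm (R (W n \<omega>) / real n - m - chain_sum g D 0 (W n \<omega>) / real n)
          \<le> 2 * F / real n) sequentially"
        using eventually_ge_at_top[of 1]
      proof eventually_elim
        case (elim n)
        then have "R (W n \<omega>) / real n - m - chain_sum g D 0 (W n \<omega>) / real n =
            (R (W n \<omega>) - m * real n - chain_sum g D 0 (W n \<omega>)) / real n"
          by (simp add: field_simps)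
        then show ?case
          using diff[OF elim random_word_in_words[OF \<open>\<omega> \<in> space M\<close>]]
          by (simp add: abs_divide divide_right_mono)
      qed
      show "(\<lambda>n. 2 * F / real n) \<longlonglongrightarrow> 0"
        by (rule lim_const_over_n)
    qed
    from tendsto_add[OF tendsto_add[OF this elim(1)] tendsto_const[of m]] show ?case by simp
  qed

  define Z where "Z n \<omega> = (R (W n \<omega>) - m * real n) / (sqrt s2 * sqrt (real n))" for n \<omega>
  have Z_meas: "Z n \<in> borel_measurable M" for n
    unfolding Z_def by (rule borel_measurable_random_word)
  have "weak_conv_m (\<lambda>n. distr M borel (Z n)) std_normal_distribution"
  proof (rule levy_continuity)
    show "real_distribution (distr M borel (Z n))" for n
      using Z_meas by (rule real_distribution_distr)
    show "real_distribution std_normal_distribution"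
      by (rule real_dist_normal_dist)
    fix t
    define \<theta> where "\<theta> n = t / sqrt (s2 * real n)" for n
    have lim: "(\<lambda>n. \<integral>\<omega>. iexp (\<theta> n * chain_sum g D 0 (W n \<omega>)) \<partial>M)
        \<longlonglongrightarrow> of_real (exp (- (t\<^sup>2) / 2))"
      unfolding \<theta>_def using closed mean0 bounded U B s2_pos by (rule char_tendsto)
    \<comment> \<open>Replacing the centred statistic by the martingale sum moves the exponent by at
      most \<open>\<bar>\<theta> n\<bar> * (2 * F)\<close>, which tends to 0.\<close>
    have "(\<lambda>n. char (distr M borel (Z n)) t -
        (\<integral>\<omega>. iexp (\<theta> n * chain_sum g D 0 (W n \<omega>)) \<partial>M)) \<longlonglongrightarrow> 0"
    proof (rule Lim_null_comparison)
      show "eventually (\<lambda>n. norm (char (distr M borel (Z n)) t -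
        (\<integral>\<omega>. iexp (\<theta> n * chain_sum g D 0 (W n \<omega>)) \<partial>M)) \<le> \<bar>\<theta> n\<bar> * (2 * F)) sequentially"
        using eventually_ge_at_top[of 1]
      proof eventually_elim
        case (elim n)
        define G where "G l = iexp (\<theta> n * (R l - m * real n))" for l
        define H where "H l = iexp (\<theta> n * chain_sum g D 0 l)" for l
        have "char (distr M borel (Z n)) t = (\<integral>\<omega>. iexp (t * Z n \<omega>) \<partial>M)"
          unfolding char_def by (rule integral_distr) (use Z_meas in auto)
        also have "\<dots> = (\<integral>\<omega>. G (W n \<omega>) \<partial>M)"
          by (simp add: Z_def G_def \<theta>_def real_sqrt_mult)
        finally have "char (distr M borel (Z n)) t - (\<integral>\<omega>. H (W n \<omega>) \<partial>M) =
            (\<integral>\<omega>. G (W n \<omega>) - H (W n \<omega>) \<partial>M)"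
          by (simp add: Bochner_Integration.integral_diff integrable_random_word[of G]
              integrable_random_word[of H])
        also have "norm \<dots> \<le> \<bar>\<theta> n\<bar> * (2 * F)"
        proof (rule norm_expectation_random_word_le)
          fix l assume l: "l \<in> words k n"
          have "norm (G l - H l) \<le> \<bar>\<theta> n * (R l - m * real n) - \<theta> n * chain_sum g D 0 l\<bar>"
            unfolding G_def H_def by (rule norm_iexp_diff_le)
          also have "\<dots> = \<bar>\<theta> n\<bar> * \<bar>R l - m * real n - chain_sum g D 0 l\<bar>"
            by (simp only: right_diff_distrib[symmetric] abs_mult)
          also have "\<dots> \<le> \<bar>\<theta> n\<bar> * (2 * F)"
            using diff[OF elim l] by (rule mult_left_mono) simp
          finally show "norm (G l - H l) \<le> \<bar>\<theta> n\<bar> * (2 * F)" .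
        qed
        finally show ?case by (simp only: H_def)
      qed
      have "(\<lambda>n. \<bar>t\<bar> / sqrt s2 * (2 * F) * (1 / sqrt (real n))) \<longlonglongrightarrow> \<bar>t\<bar> / sqrt s2 * (2 * F) * 0"
        by (intro tendsto_mult tendsto_const) real_asymp
      moreover have "\<bar>\<theta> n\<bar> * (2 * F) = \<bar>t\<bar> / sqrt s2 * (2 * F) * (1 / sqrt (real n))" for n
        using s2_pos by (simp add: \<theta>_def abs_divide real_sqrt_mult abs_mult)
      ultimately show "(\<lambda>n. \<bar>\<theta> n\<bar> * (2 * F)) \<longlonglongrightarrow> 0"
        by simp
    qed
    from tendsto_add[OF this lim]
    show "(\<lambda>n. char (distr M borel (Z n)) t) \<longlonglongrightarrow> char std_normal_distribution t"
      by (simp add: char_std_normal_distribution)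
  qed
  then show "\<exists>\<sigma>>0. weak_conv_m
      (\<lambda>n. distr M borel (\<lambda>\<omega>. (R (W n \<omega>) - m * real n) / (\<sigma> * sqrt (real n))))
      std_normal_distribution"
    using s2_pos by (intro exI[of _ "sqrt s2"]) (simp add: Z_def[abs_def])
qed

end

subsection \<open>The two chains\<close>

text \<open>The next state is independent of the current one, so averaging turns any function into a
  constant and \<open>v\<close> solves its own equation.\<close>

lemma poisson_solvable_iid:
  fixes v :: "nat \<Rightarrow> real"
  shows "\<exists>u. \<forall>x\<le>k. u x - avg k (\<lambda>a. u a) = v x - avg k v"
  by (intro exI[of _ v]) simp

lemma sum_close_letters:
  fixes v :: "nat \<Rightarrow> real"
  assumes "x \<in> {1..k}"
  shows "(\<Sum>a=1..k. if close_letters x a then v a else 0) =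
    v x + (if x < k then v (Suc x) else 0) + (if x > 1 then v (x - 1) else 0)"
proof -
  have "(\<Sum>a=1..k. if close_letters x a then v a else 0) =
      (\<Sum>a=1..k. (if a = x then v a else 0) + (if a = Suc x then v a else 0) +
        (if a = x - 1 then v a else 0))"
    using assms by (intro sum.cong) (auto simp: close_letters_def)
  also have "\<dots> = v x + (if x < k then v (Suc x) else 0) + (if x > 1 then v (x - 1) else 0)"
    using assms by (auto simp: sum.distrib)
  finally show ?thesis .
qed

text \<open>Only close letters move the state, so the operator is \<open>1 / k\<close> times the
  graph Laplacian of the path \<open>1, ..., k\<close>, with no edge beyond either end.\<close>

lemma avg_stair_move:
  fixes u :: "nat \<Rightarrow> real"
  assumes "x \<in> {1..k}"
  shows "u x - avg k (\<lambda>a. u (stair_move x a)) =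
    ((if x < k then u x - u (Suc x) else 0) + (if x > 1 then u x - u (x - 1) else 0)) / real k"
proof -
  have k: "k \<ge> 1" using assms by simp
  have "u x - avg k (\<lambda>a. u (stair_move x a)) =
      avg k (\<lambda>a. if close_letters x a then u x - u a else 0)"
  proof -
    have "u x - avg k (\<lambda>a. u (stair_move x a)) = avg k (\<lambda>a. u x - u (stair_move x a))"
      by (simp add: avg_diff avg_const[OF k])
    also have "\<dots> = avg k (\<lambda>a. if close_letters x a then u x - u a else 0)"
      using assms by (intro avg_cong) (auto simp: stair_move_def)
    finally show ?thesis .
  qed
  then show ?thesis
    using sum_close_letters[OF assms, of "\<lambda>a. u x - u a"] by (simp add: avg_def)
qed

lemma poisson_solvable_stair_move:
  fixes v :: "nat \<Rightarrow> real"
  assumes "k \<ge> 1"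
  shows "\<exists>u. \<forall>x\<le>k. u x - avg k (\<lambda>a. u (stair_move x a)) = v x - avg k v"
proof -
  define c where "c x = (\<Sum>j\<in>{1..x}. v j - avg k v)" for x
  define u0 where "u0 x = - real k * (\<Sum>y\<in>{1..<x}. c y)" for x
  \<comment> \<open>Multiplied by \<open>k\<close>, the equation on the path \<open>{1..k}\<close> says that the discrete Laplacian of
    \<open>u\<close> is \<open>- k (v - avg k v)\<close>: sum it twice. The cumulative sum \<open>c\<close> vanishes at both ends,
    which is the boundary condition at \<open>1\<close> and \<open>k\<close>.\<close>
  define u where "u x = (if x = 0 then avg k u0 + (v 0 - avg k v) else u0 x)" for x
  have c_k: "c k = 0"
    using assms by (simp add: c_def sum_subtractf avg_def)
  have c_0: "c 0 = 0" by (simp add: c_def)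
  have c_step: "c x = c (x - 1) + (v x - avg k v)" if "x \<ge> 1" for x
    using that by (cases x) (auto simp: c_def)
  have up: "u x - u (Suc x) = real k * c x" if "x \<ge> 1" for x
    using that by (simp add: u_def u0_def algebra_simps)
  have "u x - avg k (\<lambda>a. u (stair_move x a)) = v x - avg k v" if "x \<le> k" for x
  proof (cases "x = 0")
    case True
    \<comment> \<open>No letter leads back to \<open>0\<close>, so \<open>u 0\<close> enters no
      other equation and could be chosen to satisfy this one.\<close>
    have "avg k (\<lambda>a. u (stair_move 0 a)) = avg k u0"
      by (rule avg_cong) (simp add: stair_move_def u_def)
    then show ?thesis using True by (simp add: u_def)
  next
    case False
    have 1: "(if x < k then u x - u (Suc x) else 0) = real k * c x"
      using False that c_k up[of x] by (cases "x = k") auto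
    have 2: "(if x > 1 then u x - u (x - 1) else 0) = - (real k * c (x - 1))"
    proof (cases "x = 1")
      case False
      then have "x - 1 \<ge> 1" using \<open>x \<noteq> 0\<close> by linarith
      from up[OF this] show ?thesis using \<open>x \<noteq> 0\<close> False by simp
    qed (simp add: c_0)
    have "u x - avg k (\<lambda>a. u (stair_move x a)) = (real k * c x + - (real k * c (x - 1))) / real k"
      using avg_stair_move[of x k u] False that unfolding 1 2 by simp
    also have "\<dots> = c x - c (x - 1)"
      using assms by (simp add: field_simps)
    also have "\<dots> = v x - avg k v"
      using c_step[of x] False by simp
    finally show ?thesis .
  qed
  then show ?thesis by blast
qed

text \<open>Inner letters have three close letters and the two ends have two each, so 3k - 2 of the
  k^2 ordered pairs are close.\<close>

lemma avg_stair_step: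
  assumes "k \<ge> 2"
  shows "avg k (\<lambda>x. avg k (stair_step x)) = phi k"
proof -
  have "avg k (\<lambda>x. avg k (stair_step x)) =
      avg k (\<lambda>x. (3 - (if x = 1 then 1 else 0) - (if x = k then 1 else 0)) / real k)"
  proof (rule avg_cong)
    fix x assume x: "x \<in> {1..k}"
    have "avg k (stair_step x) = (\<Sum>a=1..k. if close_letters x a then 1 else 0) / real k"
      using x by (simp add: avg_def stair_step_def)
    also have "\<dots> = (3 - (if x = 1 then 1 else 0) - (if x = k then 1 else 0)) / real k"
      using x assms by (subst sum_close_letters) auto
    finally show "avg k (stair_step x) =
      (3 - (if x = 1 then 1 else 0) - (if x = k then 1 else 0)) / real k" .
  qed
  also have "\<dots> = (\<Sum>x=1..k. 3 - (if x = 1 then 1 else 0) - (if x = k then 1 else 0)) / (real k)\<^sup>2"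
    by (simp only: avg_def sum_divide_distrib[symmetric]) (simp add: power2_eq_square)
  also have "(\<Sum>x=1..k. 3 - (if x = 1 then 1 else 0) - (if x = k then 1 else 0) :: real) =
      3 * real k - 2"
    using assms by (simp add: sum_subtractf)
  finally show ?thesis by (simp add: phi_def)
qed

lemma psi_eq: "k \<ge> 1 \<Longrightarrow> psi k = 1 - phi k"
  by (simp add: psi_def phi_def field_simps power2_eq_square)

lemma avg_far_step:
  assumes "k \<ge> 2"
  shows "avg k (\<lambda>x. avg k (far_step x)) = psi k"
proof -
  have "far_step = (\<lambda>x a. 1 - stair_step x a)"
    by (auto simp: far_step_def stair_step_def fun_eq_iff)
  then have "avg k (\<lambda>x. avg k (far_step x)) = 1 - avg k (\<lambda>x. avg k (stair_step x))"
    using assms by (simp add: \<open>far_step = _\<close> avg_diff avg_const)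
  then show ?thesis
    using assms by (simp add: avg_stair_step psi_eq)
qed

text \<open>For \<open>k = 2\<close> all letters are close and \<open>psi k\<close> is 0; positivity
  from \<open>k = 3\<close> on is the source of nondegeneracy for both statistics.\<close>

lemma psi_pos: "k \<ge> 3 \<Longrightarrow> psi k > 0"
  by (simp add: psi_def)

theorem theorem1p2:
  fixes k :: nat and M :: "'a measure" and w :: "nat \<Rightarrow> 'a \<Rightarrow> nat"
  assumes "k \<ge> 3"
    and "prob_space M"
    and "prob_space.indep_vars M (\<lambda>_. count_space {1..k}) w {1..}"
    and "\<And>n. n \<ge> 1 \<Longrightarrow> distr M (count_space {1..k}) (w n) = uniform_count_measure {1..k}"
  shows
    "(AE \<omega> in M. (\<lambda>n. real (separation_number (random_word w n \<omega>)) / real n) \<longlonglongrightarrow> psi k) \<and>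
     (\<exists>\<sigma>>0. weak_conv_m
        (\<lambda>n. distr M borel
           (\<lambda>\<omega>. (real (separation_number (random_word w n \<omega>)) - psi k * real n) / (\<sigma> * sqrt (real n))))
        std_normal_distribution) \<and>
     (AE \<omega> in M. (\<lambda>n. real (leftmost_length (random_word w n \<omega>)) / real n) \<longlonglongrightarrow> phi k) \<and>
     (\<exists>\<nu>>0. weak_conv_m
        (\<lambda>n. distr M borel
           (\<lambda>\<omega>. (real (leftmost_length (random_word w n \<omega>)) - phi k * real n) / (\<nu> * sqrt (real n))))
        std_normal_distribution)"
proof -
  interpret prob_space M by fact
  interpret uniform_letters M k w
    by unfold_locales (use assms in auto)
  interpret S: letter_chain M k w "\<lambda>x a. a"
    by unfold_locales (use poisson_solvable_iid[of k] in auto)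
  interpret J: letter_chain M k w stair_move
    by unfold_locales
      (use assms(1) poisson_solvable_stair_move[of k] in \<open>auto simp: stair_move_def\<close>)
  have S: "real (separation_number l) = chain_sum (\<lambda>x a. a) far_step 0 l"
    if "l \<noteq> []" "set l \<subseteq> {1..k}" for l
    using that by (intro separation_number_eq_chain_sum) auto
  have J: "real (leftmost_length l) = chain_sum stair_move stair_step 0 l"
    if "l \<noteq> []" "set l \<subseteq> {1..k}" for l
    using that by (intro leftmost_length_eq_chain_sum) auto
  have psi: "psi k = avg k (\<lambda>x. avg k (far_step x))"
    and phi: "phi k = avg k (\<lambda>x. avg k (stair_step x))"
    using assms(1) by (simp_all add: avg_far_step avg_stair_step)
  have one: "1 \<in> {1..k}" using assms(1) by simp
  have far_1: "far_step 1 1 \<noteq> psi k"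
    using psi_pos[OF assms(1)] by (simp add: far_step_def close_letters_def)
  have move_1: "stair_move 1 1 = 1"
    by (simp add: stair_move_def)
  \<comment> \<open>The step has value 1, and \<open>phi k = 1 - psi k\<close> is below 1.\<close>
  have stair_1: "stair_step 1 1 \<noteq> phi k"
    using psi_pos[OF assms(1)] psi_eq[of k] assms(1)
    by (simp add: stair_step_def close_letters_def)
  show ?thesis
    using S.additive_functional_limits[OF S psi one one refl far_1]
      J.additive_functional_limits[OF J phi one one move_1 stair_1]
    by blast
qed

end
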